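(* Let $f(\zeta,t)$, $0\le t<\infty$, be a global in time locally univalent solution of the Polubarinova-Galin equation with $q(t)>0$ and $Q(t)=\int_0^tq(s)\,ds\to\infty$ as $t\to\infty$, and with $g=f'$ rational of the form $$g(\zeta,t)=b(t)\frac{\prod_{k=1}^{m}(\zeta-\omega_k(t))}{\prod_{j=1}^{n}(\zeta-\zeta_j(t))},\qquad m\ge n.$$ Then, for each $1\le j\le n$, $|\zeta_j(t)|\sim a_1(t)$, where $a_1(t)=f'(0,t)$. More precisely, $$\frac{1}{a_1(0)}\left(|\zeta_j(0)|+\frac{1}{|\zeta_j(0)|}-2\right)\le\frac{|\zeta_j(t)|}{a_1(t)}\le\frac{1}{a_1(0)}\left(|\zeta_j(0)|+\frac{1}{|\zeta_j(0)|}+2\right)$$ for all $t\ge0$.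
   Context: $\mathbb{D}$ is the open unit disk; dot denotes $\partial/\partial t$ and prime denotes $\partial/\partial\zeta$. Locally univalent solution: for each $t$, $f(\cdot,t)$ is analytic in a neighborhood of $\overline{\mathbb{D}}$, $f(0,t)=0$, $f'(0,t)>0$, $f'(\zeta,t)\ne0$ for $\zeta\in\overline{\mathbb{D}}$, $f$ depends smoothly on $t$, and the Polubarinova-Galin equation $\operatorname{Re}[\dot f(\zeta,t)\overline{\zeta f'(\zeta,t)}]=q(t)$ holds for $\zeta\in\partial\mathbb{D}$, where $q$ is a given continuous function. Form of $g$: $b(t)\neq0$, $|\omega_k|>1$, $|\zeta_j|>1$, no zero coincides with a pole; zeros and poles are repeated according to multiplicity. The form is preserved in time (with the same $m,n$ and multiplicities of poles), with the sole exception that when $m=n$ the degree of the numerator may drop below $n$ at one moment of time. For positive functions $a(t),b(t)$, $a(t)\sim b(t)$ means that there are constants $0<c<C<\infty$ with $c\le a(t)/b(t)\le C$ for all $t$. *)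

theory Defs
  imports "HOL-Complex_Analysis.Complex_Analysis"
begin

text \<open>
  Time-dependent functions are curried, \<open>f z t\<close> with \<open>z\<close> complex and \<open>t \<ge> 0\<close> real. Only the
  values for \<open>t \<ge> 0\<close> and \<open>z\<close> in (a neighbourhood of) the closed unit disk are meaningful.
\<close>

definition space_deriv :: "(complex \<Rightarrow> real \<Rightarrow> complex) \<Rightarrow> complex \<Rightarrow> real \<Rightarrow> complex" where
  "space_deriv f z t = deriv (\<lambda>w. f w t) z"

text \<open>The derivative at \<open>t = 0\<close> is one-sided.\<close>

definition time_deriv :: "(complex \<Rightarrow> real \<Rightarrow> complex) \<Rightarrow> complex \<Rightarrow> real \<Rightarrow> complex" where
  "time_deriv f z t = vector_derivative (\<lambda>s. f z s) (at t within {0..})"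

text \<open>
  Smooth dependence on time is continuous differentiability, uniformly up to the boundary of the
  disk. Nothing stronger is appropriate when \<open>q\<close> is merely continuous, because \<open>q\<close> inherits the
  time regularity of the time derivative of \<open>f\<close> through the Polubarinova-Galin equation.
\<close>

definition smooth_in_time :: "(complex \<Rightarrow> real \<Rightarrow> complex) \<Rightarrow> bool" where
  "smooth_in_time f \<longleftrightarrow>
     (\<forall>z\<in>cball 0 1. \<forall>t\<ge>0. (\<lambda>s. f z s) differentiable (at t within {0..})) \<and>
     continuous_on (cball 0 1 \<times> {0..}) (\<lambda>(z, t). time_deriv f z t)"

text \<open>
  Global in time locally univalent solutions. Being \<open>analytic_on\<close> the closed disk means being
  holomorphic in some open neighbourhood of it; the neighbourhood may depend on \<open>t\<close>.
\<close>

definition locally_univalent_PG_solution ::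
    "(real \<Rightarrow> real) \<Rightarrow> (complex \<Rightarrow> real \<Rightarrow> complex) \<Rightarrow> bool" where
  "locally_univalent_PG_solution q f \<longleftrightarrow>
     (\<forall>t\<ge>0. (\<lambda>z. f z t) analytic_on cball 0 1 \<and>
            f 0 t = 0 \<and>
            Im (space_deriv f 0 t) = 0 \<and> Re (space_deriv f 0 t) > 0 \<and>
            (\<forall>z\<in>cball 0 1. space_deriv f z t \<noteq> 0)) \<and>
     smooth_in_time f \<and>
     (\<forall>t\<ge>0. \<forall>z\<in>sphere 0 1. Re (time_deriv f z t * cnj (z * space_deriv f z t)) = q t)"

text \<open>
  The rational form
  \<open>g z t = b t * (\<Prod>k=1..m. z - \<omega> k t) / (\<Prod>j=1..n. z - \<zeta> j t)\<close> on the closed disk, preserved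
  in time. The number \<open>d t\<close> of finite zeros is \<open>m\<close>, except that when \<open>m = n\<close> it may be smaller at
  one instant \<open>t0\<close>; then only \<open>\<omega> 1, \<dots>, \<omega> (d t0)\<close> are used at that instant. The poles, repeated
  according to multiplicity, are labelled continuously in time, so that \<open>\<zeta> j\<close> follows one pole;
  the constancy of multiplicities says that the pattern of coincidences among them does not change.
  The zeros need not be labelled consistently in time.
\<close>

definition rational_form ::
    "(complex \<Rightarrow> real \<Rightarrow> complex) \<Rightarrow> nat \<Rightarrow> nat \<Rightarrow> (real \<Rightarrow> complex) \<Rightarrow>
     (nat \<Rightarrow> real \<Rightarrow> complex) \<Rightarrow> (nat \<Rightarrow> real \<Rightarrow> complex) \<Rightarrow> bool" where
  "rational_form g m n b \<omega> \<zeta> \<longleftrightarrow>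
     (\<exists>(d :: real \<Rightarrow> nat) (t0 :: real).
        (\<forall>t\<ge>0. d t = m \<or> (m = n \<and> t = t0 \<and> d t < n)) \<and>
        (\<forall>t\<ge>0. b t \<noteq> 0 \<and>
               (\<forall>k\<in>{1..d t}. cmod (\<omega> k t) > 1) \<and>
               (\<forall>j\<in>{1..n}. cmod (\<zeta> j t) > 1) \<and>
               (\<forall>k\<in>{1..d t}. \<forall>j\<in>{1..n}. \<omega> k t \<noteq> \<zeta> j t) \<and>
               (\<forall>z\<in>cball 0 1.
                  g z t = b t * (\<Prod>k=1..d t. z - \<omega> k t) / (\<Prod>j=1..n. z - \<zeta> j t)))) \<and>
     (\<forall>j\<in>{1..n}. continuous_on {0..} (\<zeta> j)) \<and>
     (\<forall>i\<in>{1..n}. \<forall>j\<in>{1..n}. \<forall>t\<ge>0. \<zeta> i t = \<zeta> j t \<longleftrightarrow> \<zeta> i 0 = \<zeta> j 0)"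

text \<open>The relation \<open>u \<sim> v\<close>: two-sided bounds valid for all times, not only asymptotically.\<close>

definition comparable :: "(real \<Rightarrow> real) \<Rightarrow> (real \<Rightarrow> real) \<Rightarrow> bool" where
  "comparable u v \<longleftrightarrow>
     (\<exists>c C. 0 < c \<and> c < C \<and> (\<forall>t\<ge>0. c \<le> u t / v t \<and> u t / v t \<le> C))"

end

theory Submission
  imports Defs
begin

text \<open>
  Let \<open>P\<close> be the quotient of the time derivative of \<open>f\<close> by \<open>\<zeta> f'\<close>. The Polubarinova-Galin equation
  says that \<open>Re P > 0\<close> on the circle, hence on the disk, and \<open>P(0) = a\<^sub>1' / a\<^sub>1\<close>. The reflection
  \<open>1 / cnj \<zeta>\<^sub>j\<close> of a pole is carried along by the Loewner-Kufarev flow, so that \<open>cnj \<zeta>\<^sub>j\<close> has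
  logarithmic derivative \<open>P (1 / cnj \<zeta>\<^sub>j)\<close>; Harnack's inequality for \<open>P\<close> and integration give the
  bounds.

  The poles are only assumed continuous in time. Their motion is read off from the moments
  \<open>\<oint> cnj f H'\<close> over the unit circle, which are differentiable in time and which, after integration
  by parts, are residues of the reflection of \<open>f'\<close> at the points \<open>1 / cnj \<zeta>\<^sub>j\<close>. A test function \<open>H\<close>
  that vanishes suitably at these points isolates the displacement of a single one of them.
\<close>

section \<open>Integrals over the unit circle\<close>

abbreviation circ_int :: "(complex \<Rightarrow> complex) \<Rightarrow> complex" where
  "circ_int \<equiv> contour_integral (circlepath 0 1)"

lemma circ_int_eq: "circ_int \<phi> = integral {0..2*pi} (\<lambda>\<theta>. \<phi> (cis \<theta>) * (\<i> * cis \<theta>))"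
  unfolding circlepath_def
  by (subst contour_integral_part_circlepath_eq) (simp_all add: mult_ac)

lemma circ_int_cong: "(\<And>z. cmod z = 1 \<Longrightarrow> \<phi> z = \<psi> z) \<Longrightarrow> circ_int \<phi> = circ_int \<psi>"
  by (rule contour_integral_eq) (auto simp: dist_norm)

lemma circ_integrable: "continuous_on (sphere 0 1) \<phi> \<Longrightarrow> \<phi> contour_integrable_on circlepath 0 1"
  by (rule contour_integrable_continuous_circlepath) simp

text \<open>Gives continuity in time of the moments and of the Cauchy integrals of time difference
  quotients used below.\<close>

lemma circ_int_continuous_param:
  assumes "continuous_on (S \<times> sphere 0 1) (\<lambda>(t, z). \<phi> t z)"
  shows "continuous_on S (\<lambda>t :: real. circ_int (\<phi> t))"
proof -
  have "continuous_on (S \<times> cbox 0 (2*pi)) (\<lambda>(t, \<theta>). \<phi> t (cis \<theta>) * (\<i> * cis \<theta>))"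
    unfolding case_prod_beta
    by (intro continuous_intros continuous_on_compose2[OF assms[unfolded case_prod_beta],
          of _ "\<lambda>p. (fst p, cis (snd p))", simplified]) auto
  from integral_continuous_on_param[OF this] show ?thesis
    by (simp add: circ_int_eq)
qed

text \<open>This is Cauchy's formula at the origin for \<open>u * \<phi> u\<close>, which vanishes
  there; only continuity is needed on the circle itself.\<close>

lemma Cauchy_circ_int:
  assumes "continuous_on (cball 0 1) \<phi>" "\<phi> holomorphic_on ball 0 1"
  shows "circ_int \<phi> = 0"
proof -
  have "((\<lambda>u. (\<phi> u * u) / (u - 0)) has_contour_integral (2 * of_real pi * \<i> * (\<phi> 0 * 0))) (circlepath 0 1)"
    by (intro Cauchy_integral_circlepath continuous_intros holomorphic_intros assms) auto
  then have "circ_int (\<lambda>u. (\<phi> u * u) / (u - 0)) = 0"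
    by (simp add: contour_integral_unique)
  moreover have "circ_int (\<lambda>u. (\<phi> u * u) / (u - 0)) = circ_int \<phi>"
    by (rule circ_int_cong) auto
  ultimately show ?thesis by simp
qed

text \<open>Since \<open>1 - y * z = - y * (z - 1 / y)\<close> and \<open>1 / y\<close> lies in the
  open disk, this is Cauchy's formula at \<open>1 / y\<close> with the factor
  \<open>- 1 / y\<close>.\<close>

lemma Cauchy_circ_int_reflected_pole:
  assumes "continuous_on (cball 0 1) \<phi>" "\<phi> holomorphic_on ball 0 1" "cmod y > 1"
  shows "circ_int (\<lambda>z. \<phi> z / (1 - y * z)) = - (2 * pi * \<i> / y * \<phi> (1 / y))"
proof -
  have y: "y \<noteq> 0" using assms by auto
  have "((\<lambda>u. (- \<phi> u / y) / (u - 1 / y)) has_contour_integral (2 * of_real pi * \<i> * (- \<phi> (1/y) / y))) (circlepath 0 1)"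
    using assms y by (intro Cauchy_integral_circlepath continuous_intros holomorphic_intros)
      (auto simp: norm_divide)
  then have "circ_int (\<lambda>u. (- \<phi> u / y) / (u - 1 / y)) = 2 * of_real pi * \<i> * (- \<phi> (1/y) / y)"
    by (simp add: contour_integral_unique)
  moreover have "circ_int (\<lambda>u. (- \<phi> u / y) / (u - 1 / y)) = circ_int (\<lambda>z. \<phi> z / (1 - y * z))"
  proof (rule circ_int_cong)
    fix z :: complex assume z: "cmod z = 1"
    have "y * z \<noteq> 1" using assms z by (metis less_irrefl mult.right_neutral norm_mult norm_one)
    then have "1 - y * z \<noteq> 0" "z - 1 / y \<noteq> 0" using y by (auto simp: field_simps)
    then show "- \<phi> z / y / (z - 1 / y) = \<phi> z / (1 - y * z)"
      using y by (simp add: divide_simps) (simp add: algebra_simps)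
  qed
  ultimately show ?thesis by simp
qed

lemma has_vector_derivative_cis: "(cis has_vector_derivative \<i> * cis \<theta>) (at \<theta> within A)"
proof -
  have "((\<lambda>t. exp (\<i> * of_real t)) has_vector_derivative (\<i> * exp (\<i> * of_real \<theta>))) (at \<theta> within A)"
    by (rule has_vector_derivative_real_field) (auto intro!: derivative_eq_intros)
  then show ?thesis by (simp add: cis_conv_exp[abs_def])
qed

text \<open>On the unit circle \<open>cnj (dz) = - dz / z\<^sup>2\<close>.\<close>

lemma circ_int_by_parts:
  assumes f: "f analytic_on sphere 0 1"
    and H: "\<And>z. (H has_field_derivative H' z) (at z)" and cH': "continuous_on (sphere 0 1) H'"
  shows "circ_int (\<lambda>z. cnj (f z) * H' z) = circ_int (\<lambda>z. cnj (deriv f z) * H z / z\<^sup>2)"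
proof -
  let ?F = "\<lambda>\<theta>. cnj (f (cis \<theta>)) * H (cis \<theta>)"
  have cf: "continuous_on (sphere 0 1) f"
    using f analytic_imp_holomorphic holomorphic_on_imp_continuous_on by blast
  have cf': "continuous_on (sphere 0 1) (deriv f)"
    using f analytic_deriv analytic_imp_holomorphic holomorphic_on_imp_continuous_on by blast
  have cH: "continuous_on (sphere 0 1) H"
    by (rule DERIV_continuous_on[OF has_field_derivative_at_within[OF H]])
  have "(?F has_vector_derivative (cnj (f (cis \<theta>)) * H' (cis \<theta>) * (\<i> * cis \<theta>) -
          cnj (deriv f (cis \<theta>)) * H (cis \<theta>) / (cis \<theta>)\<^sup>2 * (\<i> * cis \<theta>))) (at \<theta> within {0..2*pi})" for \<theta>
  proof -
    have "(f has_field_derivative deriv f (cis \<theta>)) (at (cis \<theta>))"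
      using f by (intro analytic_derivI) (auto intro: analytic_on_subset)
    then have 1: "((f \<circ> cis) has_vector_derivative \<i> * cis \<theta> * deriv f (cis \<theta>)) (at \<theta> within {0..2*pi})"
      by (rule field_vector_diff_chain_within[OF has_vector_derivative_cis has_field_derivative_at_within])
    have 2: "((H \<circ> cis) has_vector_derivative \<i> * cis \<theta> * H' (cis \<theta>)) (at \<theta> within {0..2*pi})"
      by (rule field_vector_diff_chain_within[OF has_vector_derivative_cis has_field_derivative_at_within[OF H]])
    have 3: "((\<lambda>\<theta>. cnj ((f \<circ> cis) \<theta>)) has_vector_derivative cnj (\<i> * cis \<theta> * deriv f (cis \<theta>))) (at \<theta> within {0..2*pi})"
      by (rule has_vector_derivative_cnj[OF 1])
    have cc: "cnj (cis \<theta>) = 1 / cis \<theta>" by (simp add: cis_cnj inverse_eq_divide[symmetric])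
    from has_vector_derivative_mult[OF 3 2] show ?thesis
      by (simp add: cc power2_eq_square algebra_simps o_def)
  qed
  then have "((\<lambda>\<theta>. cnj (f (cis \<theta>)) * H' (cis \<theta>) * (\<i> * cis \<theta>) -
          cnj (deriv f (cis \<theta>)) * H (cis \<theta>) / (cis \<theta>)\<^sup>2 * (\<i> * cis \<theta>)) has_integral
          (?F (2*pi) - ?F 0)) {0..2*pi}"
    by (intro fundamental_theorem_of_calculus) auto
  \<comment> \<open>The boundary terms cancel because \<open>cis\<close> takes the same value at 0
    and \<open>2*pi\<close>.\<close>
  then have "integral {0..2*pi} (\<lambda>\<theta>. cnj (f (cis \<theta>)) * H' (cis \<theta>) * (\<i> * cis \<theta>) -
          cnj (deriv f (cis \<theta>)) * H (cis \<theta>) / (cis \<theta>)\<^sup>2 * (\<i> * cis \<theta>)) = 0"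
    by (simp add: integral_unique)
  moreover have "integral {0..2*pi} (\<lambda>\<theta>. cnj (f (cis \<theta>)) * H' (cis \<theta>) * (\<i> * cis \<theta>) -
          cnj (deriv f (cis \<theta>)) * H (cis \<theta>) / (cis \<theta>)\<^sup>2 * (\<i> * cis \<theta>)) =
       circ_int (\<lambda>z. cnj (f z) * H' z) - circ_int (\<lambda>z. cnj (deriv f z) * H z / z\<^sup>2)"
    unfolding circ_int_eq
    by (intro integral_diff integrable_continuous_interval continuous_intros
        continuous_on_compose2[OF cf] continuous_on_compose2[OF cf'] continuous_on_compose2[OF cH]
        continuous_on_compose2[OF cH']) auto
  ultimately show ?thesis by simp
qed

section \<open>Harnack's inequality\<close>

text \<open>The real part equals \<open>(1 - |W|^2) / |1 - W|^2\<close>, and \<open>|1 - W|\<close>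
  lies between \<open>1 - |W|\<close> and \<open>1 + |W|\<close>. The resulting bounds are monotone
  in \<open>|W|\<close>.\<close>

lemma Re_Cayley_bounds:
  fixes W :: complex
  assumes "cmod W \<le> r" "r < 1"
  shows "(1 - r) / (1 + r) \<le> Re ((1 + W) / (1 - W))" "Re ((1 + W) / (1 - W)) \<le> (1 + r) / (1 - r)"
proof -
  define w where "w = cmod W"
  have w: "0 \<le> w" "w \<le> r" "w < 1" using assms by (auto simp: w_def)
  have a: "1 - w \<le> cmod (1 - W)" "cmod (1 - W) \<le> 1 + w"
    using norm_triangle_ineq2[of 1 W] norm_triangle_ineq4[of 1 W] by (auto simp: w_def)
  have W2: "(Re W)\<^sup>2 + (Im W)\<^sup>2 = w\<^sup>2" by (simp add: w_def cmod_power2)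
  have eq: "Re ((1 + W) / (1 - W)) = (1 - w\<^sup>2) / (cmod (1 - W))\<^sup>2"
    by (simp add: Re_divide cmod_power2 W2[symmetric]) (simp add: algebra_simps power2_eq_square)
  have p: "0 < (1-w)" "0 < cmod (1 - W)" using w a by auto
  have "(1 - r) / (1 + r) \<le> (1 - w) / (1 + w)" using w assms by (intro frac_le) auto
  also have "\<dots> = (1 - w\<^sup>2) / (1 + w)\<^sup>2"
    using w by (simp add: divide_simps power2_eq_square) (simp add: algebra_simps)
  also have "\<dots> \<le> (1 - w\<^sup>2) / (cmod (1 - W))\<^sup>2"
    using w a p by (intro divide_left_mono power_mono mult_pos_pos) (auto simp: power_le_one)
  finally show "(1 - r) / (1 + r) \<le> Re ((1 + W) / (1 - W))" by (simp add: eq)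
  have "(1 - w\<^sup>2) / (cmod (1 - W))\<^sup>2 \<le> (1 - w\<^sup>2) / (1 - w)\<^sup>2"
    using w a p by (intro divide_left_mono power_mono mult_pos_pos) (auto simp: power_le_one)
  also have "\<dots> = (1 + w) / (1 - w)"
    using w by (simp add: divide_simps power2_eq_square) (simp add: algebra_simps)
  also have "\<dots> \<le> (1 + r) / (1 - r)" using w assms by (intro frac_le) auto
  finally show "Re ((1 + W) / (1 - W)) \<le> (1 + r) / (1 - r)" by (simp add: eq)
qed

text \<open>The maximum modulus principle for \<open>exp (- P)\<close>, whose modulus is
  \<open>exp (- Re P)\<close>. Compactness of the circle supplies a positive minimum of
  \<open>Re P\<close>, so strictness is kept.\<close>

lemma Re_pos_of_boundary:
  assumes c: "continuous_on (cball 0 1) P" and h: "P holomorphic_on ball 0 1"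
    and pos: "\<And>z. cmod z = 1 \<Longrightarrow> Re (P z) > 0" and z: "cmod z < 1"
  shows "Re (P z) > 0"
proof -
  have "\<exists>x\<in>sphere 0 1. \<forall>y\<in>sphere 0 1. Re (P x) \<le> Re (P y)"
    by (intro continuous_attains_inf continuous_intros continuous_on_subset[OF c]) auto
  then obtain x where x: "x \<in> sphere 0 1" "\<forall>y\<in>sphere 0 1. Re (P x) \<le> Re (P y)" by blast
  have "cmod (exp (- P z)) \<le> exp (- Re (P x))"
    by (rule maximum_modulus_frontier[where S = "ball 0 1"])
       (use x z in \<open>auto intro!: holomorphic_intros continuous_intros h c\<close>)
  then have "Re (P x) \<le> Re (P z)" by simp
  with pos x show ?thesis by (metis less_le_trans mem_sphere_0)
qed

text \<open>The map \<open>u \<mapsto> (u - p) / (u + p)\<close> carries the right half-plane to the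
  disk and \<open>p\<close> to 0. Schwarz's lemma therefore applies to \<open>W\<close>, and solving
  for \<open>P\<close> turns \<open>|W z| \<le> |z|\<close> into Harnack's bounds.\<close>

lemma Harnack_disk:
  assumes c: "continuous_on (cball 0 1) P" and h: "P holomorphic_on ball 0 1"
    and pos: "\<And>z. cmod z = 1 \<Longrightarrow> Re (P z) > 0" and z: "cmod z < 1"
    and re: "P 0 = of_real p"
  shows "(1 - cmod z) / (1 + cmod z) * p \<le> Re (P z)" "Re (P z) \<le> (1 + cmod z) / (1 - cmod z) * p"
    "p > 0"
proof -
  have pos': "Re (P u) > 0" if "cmod u < 1" for u
    using Re_pos_of_boundary[OF c h pos that] .
  show p: "p > 0" using pos'[of 0] re by auto
  define W where "W = (\<lambda>z. (P z - p) / (P z + p))"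
  have nz: "P u + p \<noteq> 0" if "cmod u < 1" for u
    using pos'[OF that] p by (auto simp: complex_eq_iff)
  have hW: "W holomorphic_on ball 0 1"
    unfolding W_def by (intro holomorphic_intros h) (use nz in auto)
  have lt: "cmod (W u) < 1" if "cmod u < 1" for u
  proof -
    have "(cmod (P u - p))\<^sup>2 < (cmod (P u + p))\<^sup>2"
      using pos'[OF that] p unfolding cmod_power2 by (simp add: power2_eq_square algebra_simps)
    then have "cmod (P u - p) < cmod (P u + p)" by (rule power2_less_imp_less) simp
    then show ?thesis by (auto simp: W_def norm_divide divide_simps)
  qed
  have le: "cmod (W z) \<le> cmod z"
    by (rule Schwarz_Lemma(1)[OF hW _ lt z]) (simp_all add: W_def re)
  have "1 - W z = 2 * p / (P z + p)" "1 + W z = 2 * P z / (P z + p)"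
    using nz[OF z] by (simp_all add: W_def field_simps)
  then have "P z = of_real p * ((1 + W z) / (1 - W z))"
    using nz[OF z] p by simp
  then have eq: "Re (P z) = p * Re ((1 + W z) / (1 - W z))"
    by (metis scaleR_complex.simps(1) scaleR_conv_of_real)
  show "(1 - cmod z) / (1 + cmod z) * p \<le> Re (P z)" "Re (P z) \<le> (1 + cmod z) / (1 - cmod z) * p"
    using mult_left_mono[OF Re_Cayley_bounds(1)[OF le z], of p]
      mult_left_mono[OF Re_Cayley_bounds(2)[OF le z], of p] p by (simp_all add: eq mult.commute)
qed

section \<open>Differentiation in time\<close>

text \<open>Ensures that limits and derivatives within the time half-line are unique, including the
  one-sided ones at time 0.\<close>

lemma at_within_atLeast_neq_bot:
  fixes s :: real
  assumes "s \<ge> 0"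
  shows "at s within {0..} \<noteq> bot"
proof -
  have "at_right s \<le> at s within {0..}"
    using assms by (intro at_le) auto
  then show ?thesis
    using trivial_limit_at_right_real[of s] by (metis bot.extremum_uniqueI)
qed

text \<open>Passes an identity for genuine difference quotients to the limiting time
  \<open>s\<close>.\<close>

lemma continuous_on_eq_at_removed_time:
  fixes F G :: "real \<Rightarrow> complex"
  assumes "continuous_on {0..} F" "continuous_on {0..} G" "s \<ge> 0"
    and eq: "\<And>t. t \<ge> 0 \<Longrightarrow> t \<noteq> s \<Longrightarrow> F t = G t"
  shows "F s = G s"
proof -
  have "(F \<longlongrightarrow> F s) (at s within {0..})" "(G \<longlongrightarrow> G s) (at s within {0..})"
    using assms by (auto simp: continuous_on_def)
  moreover have "\<forall>\<^sub>F t in at s within {0..}. F t = G t"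
    unfolding eventually_at_filter using eq by (intro always_eventually) auto
  ultimately show ?thesis
    using tendsto_cong tendsto_unique[OF at_within_atLeast_neq_bot[OF \<open>s \<ge> 0\<close>]] by blast
qed

text \<open>Caratheodory's form of the derivative: a factor of the increment that is continuous at
  \<open>s\<close> has the derivative as its value there.\<close>

lemma has_vector_derivative_of_factor:
  fixes F :: "real \<Rightarrow> complex"
  assumes c: "continuous (at s within S) q"
    and eq: "\<forall>\<^sub>F t in at s within S. F t - F s = of_real (t - s) * q t"
  shows "(F has_vector_derivative q s) (at s within S)"
proof -
  have "(q \<longlongrightarrow> q s) (at s within S)" using c by (simp add: continuous_within)
  then have "((\<lambda>t. norm (q t - q s)) \<longlongrightarrow> 0) (at s within S)"
    by (intro tendsto_norm_zero LIM_zero)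
  then have "((\<lambda>t. norm (F t - F s - (t - s) *\<^sub>R q s) / norm (t - s)) \<longlongrightarrow> 0) (at s within S)"
  proof (rule Lim_transform_eventually)
    show "\<forall>\<^sub>F t in at s within S. norm (q t - q s) = norm (F t - F s - (t - s) *\<^sub>R q s) / norm (t - s)"
      using eq eventually_neq_at_within[of s s S]
    proof eventually_elim
      case (elim t)
      have "F t - F s - (t - s) *\<^sub>R q s = (t - s) *\<^sub>R (q t - q s)"
        unfolding elim(1) by (simp only: scaleR_conv_of_real right_diff_distrib)
      then show ?case using elim(2) by simp
    qed
  qed
  then show ?thesis
    by (simp add: has_vector_derivative_def has_derivative_iff_norm bounded_linear_scaleR_left)
qed

text \<open>\<open>Q t z\<close> is the mean of the time derivative over the segment from
  \<open>s\<close> to \<open>t\<close>. It is jointly continuous and equals the time derivative at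
  \<open>t = s\<close>, so limits in \<open>t\<close> can be taken under integrals over the
  circle.\<close>

lemma smooth_in_time_quotient:
  assumes f: "smooth_in_time f" and s: "s \<ge> 0"
  obtains Q where "continuous_on ({0..} \<times> cball 0 1) (\<lambda>(t, z). Q t z)"
    "\<And>t z. t \<ge> 0 \<Longrightarrow> z \<in> cball 0 1 \<Longrightarrow> f z t - f z s = of_real (t - s) * Q t z"
    "\<And>z. Q s z = time_deriv f z s"
proof
  define Q where "Q = (\<lambda>t z. integral (cbox 0 (1::real)) (\<lambda>u. time_deriv f z (s + u * (t - s))))"
  have cont: "continuous_on (cball 0 1 \<times> {0..}) (\<lambda>p. time_deriv f (fst p) (snd p))"
    using f by (simp add: smooth_in_time_def case_prod_beta)
  have nonneg: "0 \<le> s + u * (t - s)" if "t \<ge> 0" "0 \<le> u" "u \<le> 1" for u t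
  proof -
    have "s + u * (t - s) = (1 - u) * s + u * t" by (simp add: algebra_simps)
    then show ?thesis using that s by simp
  qed
  have "continuous_on (({0..} \<times> cball 0 1) \<times> cbox 0 1)
      (\<lambda>(p, u). time_deriv f (snd p) (s + u * (fst p - s)))"
    unfolding case_prod_beta
    by (rule continuous_on_compose2[OF cont, of _ "\<lambda>p. (snd (fst p), s + snd p * (fst (fst p) - s))", simplified])
       (auto intro!: continuous_intros nonneg)
  from integral_continuous_on_param[OF this]
  show "continuous_on ({0..} \<times> cball 0 1) (\<lambda>(t, z). Q t z)"
    by (simp add: Q_def case_prod_beta)
  show "Q s z = time_deriv f z s" for z
    by (simp add: Q_def)
  show "f z t - f z s = of_real (t - s) * Q t z" if t: "t \<ge> 0" and z: "z \<in> cball 0 1" for t z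
  proof -
    have d: "(f z has_vector_derivative time_deriv f z \<tau>) (at \<tau> within {0..})" if "\<tau> \<ge> 0" for \<tau>
      using f z that unfolding smooth_in_time_def time_deriv_def
      by (metis vector_derivative_works)
    have "((\<lambda>u. f z (s + u * (t - s))) has_vector_derivative
            (t - s) *\<^sub>R time_deriv f z (s + u * (t - s))) (at u within {0..1})" if u: "u \<in> {0..1}" for u
    proof -
      have "((\<lambda>u. s + u * (t - s)) has_vector_derivative (t - s)) (at u within {0..1})"
        by (auto intro!: derivative_eq_intros)
      moreover have "(f z has_vector_derivative time_deriv f z (s + u * (t - s)))
           (at (s + u * (t - s)) within (\<lambda>u. s + u * (t - s)) ` {0..1})"
        using u t by (intro has_vector_derivative_within_subset[OF d]) (auto intro!: nonneg)
      ultimately show ?thesis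
        using vector_diff_chain_within by (fastforce simp: o_def)
    qed
    then have "((\<lambda>u. (t - s) *\<^sub>R time_deriv f z (s + u * (t - s))) has_integral
        (f z (s + 1 * (t - s)) - f z (s + 0 * (t - s)))) {0..1}"
      by (intro fundamental_theorem_of_calculus) auto
    then have "f z t - f z s = integral {0..1} (\<lambda>u. (t - s) *\<^sub>R time_deriv f z (s + u * (t - s)))"
      by (simp add: integral_unique del: integral_cmul)
    then show ?thesis by (simp add: Q_def scaleR_conv_of_real)
  qed
qed

text \<open>Differentiation of Cauchy's formula under the integral. Holomorphy is a conclusion here:
  only the formula and boundary continuity are assumed.\<close>

lemma Cauchy_formula_derivative:
  assumes c: "continuous_on (sphere 0 1) \<phi>"
    and i: "\<And>w. cmod w < 1 \<Longrightarrow> circ_int (\<lambda>z. \<phi> z / (z - w)) = 2 * pi * \<i> * \<phi> w"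
    and w: "cmod w < 1"
  shows "(\<phi> has_field_derivative circ_int (\<lambda>z. \<phi> z / (z - w)\<^sup>2) / (2 * pi * \<i>)) (at w)"
proof -
  have "((\<lambda>w. 2 * pi * \<i> * \<phi> w) has_field_derivative (of_nat 1 * circ_int (\<lambda>u. \<phi> u/(u-w)^(Suc 1)))) (at w)"
  proof (rule Cauchy_next_derivative_circlepath(2))
    show "((\<lambda>u. \<phi> u / (u - v) ^ 1) has_contour_integral 2 * pi * \<i> * \<phi> v) (circlepath 0 1)"
      if "v \<in> ball 0 1" for v
    proof -
      have "(\<lambda>u. \<phi> u / (u - v)) contour_integrable_on circlepath 0 1"
        using that by (intro circ_integrable continuous_intros c) auto
      then show ?thesis using has_contour_integral_integral i[of v] that by fastforce
    qed
  qed (use c w in auto)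
  then have "((\<lambda>w. (2 * pi * \<i> * \<phi> w) / (2 * pi * \<i>)) has_field_derivative
     (of_nat 1 * circ_int (\<lambda>u. \<phi> u/(u-w)^(Suc 1))) / (2 * pi * \<i>)) (at w)"
    by (rule DERIV_cdivide)
  then show ?thesis by (simp add: power2_eq_square)
qed

lemma continuous_on_section:
  assumes "continuous_on (S \<times> C) (\<lambda>(t, z). Q t z)" "t \<in> S"
  shows "continuous_on C (Q t)"
  by (rule continuous_on_compose2[OF assms(1)[unfolded case_prod_beta], of _ "\<lambda>z. (t, z)", simplified])
     (auto intro!: continuous_intros assms)

text \<open>For \<open>t \<noteq> s\<close> the function \<open>Q t\<close> is a difference quotient
  of holomorphic functions and satisfies Cauchy's formula. Continuity in \<open>t\<close> extends
  the formula to \<open>t = s\<close>, so the time derivative is holomorphic in the disk. The same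
  formula lets the time derivative commute with the space derivative at 0.\<close>

lemma quotient_holomorphic:
  assumes f: "\<And>t. t \<ge> 0 \<Longrightarrow> continuous_on (cball 0 1) (\<lambda>z. f z t) \<and> (\<lambda>z. f z t) holomorphic_on ball 0 1"
    and s: "s \<ge> 0"
    and Q: "continuous_on ({0..} \<times> cball 0 1) (\<lambda>(t, z). Q t z)"
    and eq: "\<And>t z. t \<ge> 0 \<Longrightarrow> z \<in> cball 0 1 \<Longrightarrow> f z t - f z s = of_real (t - s) * Q t z"
  shows "Q s holomorphic_on ball 0 1"
    and "((\<lambda>t. deriv (\<lambda>z. f z t) 0) has_vector_derivative deriv (Q s) 0) (at s within {0..})"
proof -
  have Qt: "continuous_on (cball 0 1) (Q t)" if "t \<ge> 0" for t
    using continuous_on_section[OF Q] that by auto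
  have QS: "continuous_on ({0..} \<times> sphere 0 1) (\<lambda>p. Q (fst p) (snd p))"
    by (rule continuous_on_subset[OF Q[unfolded case_prod_beta]]) auto
  have Qd: "continuous_on {0..} (\<lambda>t. circ_int (\<lambda>z. Q t z / (z - w) ^ k))" if "cmod w < 1" for w k
    by (rule circ_int_continuous_param, unfold case_prod_beta)
       (use that in \<open>auto intro!: continuous_intros QS\<close>)
  have neq: "circ_int (\<lambda>z. Q t z / (z - w)) = 2 * pi * \<i> * Q t w"
    if t: "t \<ge> 0" "t \<noteq> s" and w: "cmod w < 1" for t w
  proof -
    have Qeq: "Q t z = (f z t - f z s) / of_real (t - s)" if "z \<in> cball 0 1" for z
      using eq[OF t(1) that] t by simp
    have "Q t holomorphic_on ball 0 1"
      by (rule holomorphic_transform[of "\<lambda>z. (f z t - f z s) / of_real (t - s)"])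
         (use t f s Qeq in \<open>auto intro!: holomorphic_intros\<close>)
    from Cauchy_integral_circlepath[OF Qt[OF t(1)] this, of w] w
    show ?thesis by (simp add: contour_integral_unique)
  qed
  have C: "circ_int (\<lambda>z. Q t z / (z - w)) = 2 * pi * \<i> * Q t w"
    if t: "t \<ge> 0" and w: "cmod w < 1" for t w
  proof (cases "t = s")
    case True
    have "continuous_on {0..} (\<lambda>t. Q t w)"
      by (rule continuous_on_compose2[OF Q[unfolded case_prod_beta], of _ "\<lambda>t. (t, w)", simplified])
         (use w in \<open>auto intro!: continuous_intros\<close>)
    then show ?thesis unfolding True using Qd[OF w, of 1]
      by (intro continuous_on_eq_at_removed_time[OF _ _ s neq]) (auto intro!: continuous_intros w)
  qed (use neq that in auto)
  have D: "(Q t has_field_derivative circ_int (\<lambda>z. Q t z / (z - w)\<^sup>2) / (2 * pi * \<i>)) (at w)"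
    if "t \<ge> 0" "cmod w < 1" for t w
    by (rule Cauchy_formula_derivative)
       (use that C in \<open>auto intro: continuous_on_subset[OF Qt]\<close>)
  show "Q s holomorphic_on ball 0 1"
    unfolding holomorphic_on_open[OF open_ball] using D[OF s] mem_ball_0 by blast
  \<comment> \<open>\<open>E t\<close> is the derivative of \<open>Q t\<close> at 0 written as a
    Cauchy integral, which makes its continuity in \<open>t\<close> visible; it then serves as
    Caratheodory's factor.\<close>
  define E where "E = (\<lambda>t. circ_int (\<lambda>z. Q t z / (z - 0)\<^sup>2) / (2 * pi * \<i>))"
  have "continuous_on {0..} E"
    unfolding E_def using Qd[of 0 2] by (auto intro!: continuous_intros)
  then have cE: "continuous (at s within {0..}) E"
    using s by (simp add: continuous_on_eq_continuous_within)
  have QE: "(Q t has_field_derivative E t) (at 0)" if "t \<ge> 0" for t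
    using D[OF that, of 0] by (simp add: E_def)
  have "deriv (\<lambda>z. f z t) 0 - deriv (\<lambda>z. f z s) 0 = of_real (t - s) * E t" if t: "t \<ge> 0" for t
  proof -
    have fd: "((\<lambda>z. f z s) has_field_derivative deriv (\<lambda>z. f z s) 0) (at 0)"
      using f[OF s] holomorphic_derivI[of _ "ball 0 1" 0] by auto
    have "((\<lambda>z. f z s + of_real (t - s) * Q t z) has_field_derivative
        (deriv (\<lambda>z. f z s) 0 + of_real (t - s) * E t)) (at 0)"
      by (intro DERIV_add DERIV_cmult fd QE t)
    then have "((\<lambda>z. f z t) has_field_derivative (deriv (\<lambda>z. f z s) 0 + of_real (t - s) * E t)) (at 0)"
      by (rule has_field_derivative_transform_within[of _ _ _ _ 1])
         (use eq[OF t] in \<open>auto simp: algebra_simps dist_norm\<close>)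
    then show ?thesis by (simp add: DERIV_imp_deriv)
  qed
  then have "\<forall>\<^sub>F t in at s within {0..}. deriv (\<lambda>z. f z t) 0 - deriv (\<lambda>z. f z s) 0 = of_real (t - s) * E t"
    unfolding eventually_at_filter by (intro always_eventually) auto
  from has_vector_derivative_of_factor[OF cE this]
  show "((\<lambda>t. deriv (\<lambda>z. f z t) 0) has_vector_derivative deriv (Q s) 0) (at s within {0..})"
    using QE[OF s] by (simp add: DERIV_imp_deriv)
qed

section \<open>The Loewner-Kufarev equation\<close>

lemma divide_zero_at_origin:
  assumes c: "continuous_on (cball 0 1) \<phi>" and h: "\<phi> holomorphic_on ball 0 1" and 0: "\<phi> 0 = 0"
  obtains k where "continuous_on (cball 0 1) k" "k holomorphic_on ball 0 1" "\<And>z. \<phi> z = z * k z"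
    "k 0 = deriv \<phi> 0"
proof
  \<comment> \<open>The value at 0 removes the singularity. Continuity up to the circle is then
    checked separately at 0 and away from it.\<close>
  define k where "k = (\<lambda>z. if z = 0 then deriv \<phi> 0 else \<phi> z / z)"
  show hk: "k holomorphic_on ball 0 1"
    by (rule pole_theorem_open_0[OF h, of 0]) (auto simp: k_def 0)
  show "continuous_on (cball 0 1) k"
    unfolding continuous_on_eq_continuous_within
  proof
    fix z :: complex assume z: "z \<in> cball 0 1"
    show "continuous (at z within cball 0 1) k"
    proof (cases "z = 0")
      case True
      have "isCont k 0"
        by (rule continuous_on_interior[OF holomorphic_on_imp_continuous_on[OF hk]]) simp
      then show ?thesis using True continuous_at_imp_continuous_at_within by blast
    next
      case False
      have "continuous (at z within cball 0 1) (\<lambda>z. \<phi> z / z)"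
        using c z False by (auto intro!: continuous_intros simp: continuous_on_eq_continuous_within)
      then show ?thesis
        by (rule continuous_transform_within[where \<delta> = "cmod z"])
           (use z False in \<open>auto simp: k_def dist_norm\<close>)
    qed
  qed
qed (auto simp: 0)

text \<open>The time derivative vanishes at the origin and \<open>f'\<close> has no zero in the
  closed disk, so division by \<open>z * f'\<close> gives a regular \<open>P\<close>. On the circle
  the Polubarinova-Galin equation reads \<open>|z f'|^2 * Re P = q\<close>. The number
  \<open>p\<close> is the logarithmic derivative of \<open>f'(0,t)\<close> at
  \<open>s\<close>.\<close>

lemma PG_Loewner_Kufarev:
  assumes sol: "locally_univalent_PG_solution q f" and q: "q s > 0" and s: "s \<ge> 0"
  obtains P p where "continuous_on (cball 0 1) P" "P holomorphic_on ball 0 1"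
    "\<And>z. z \<in> cball 0 1 \<Longrightarrow> time_deriv f z s = z * space_deriv f z s * P z"
    "\<And>z. cmod z = 1 \<Longrightarrow> Re (P z) > 0" "P 0 = complex_of_real p"
    "((\<lambda>t. Re (space_deriv f 0 t)) has_real_derivative p * Re (space_deriv f 0 s)) (at s within {0..})"
proof -
  have an: "(\<lambda>z. f z t) analytic_on cball 0 1" and f0: "f 0 t = 0"
    and im: "Im (space_deriv f 0 t) = 0" and rp: "Re (space_deriv f 0 t) > 0"
    and nz: "\<And>z. z \<in> cball 0 1 \<Longrightarrow> space_deriv f z t \<noteq> 0" if "t \<ge> 0" for t
    using sol that by (auto simp: locally_univalent_PG_solution_def)
  have sm: "smooth_in_time f"
    and PG: "\<And>z. cmod z = 1 \<Longrightarrow> Re (time_deriv f z s * cnj (z * space_deriv f z s)) = q s"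
    using sol s by (auto simp: locally_univalent_PG_solution_def)
  obtain Q where Q: "continuous_on ({0..} \<times> cball 0 1) (\<lambda>(t, z). Q t z)"
    "\<And>t z. t \<ge> 0 \<Longrightarrow> z \<in> cball 0 1 \<Longrightarrow> f z t - f z s = of_real (t - s) * Q t z"
    "\<And>z. Q s z = time_deriv f z s"
    using smooth_in_time_quotient[OF sm s] by blast
  have fc: "continuous_on (cball 0 1) (\<lambda>z. f z t) \<and> (\<lambda>z. f z t) holomorphic_on ball 0 1" if "t \<ge> 0" for t
    using an[OF that] analytic_imp_holomorphic holomorphic_on_imp_continuous_on
      holomorphic_on_subset[OF _ ball_subset_cball] by blast
  have hQ: "Q s holomorphic_on ball 0 1"
    and dQ: "((\<lambda>t. deriv (\<lambda>z. f z t) 0) has_vector_derivative deriv (Q s) 0) (at s within {0..})"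
    using quotient_holomorphic[OF fc s Q(1,2)] by auto
  have cQ: "continuous_on (cball 0 1) (Q s)"
    using continuous_on_section[OF Q(1)] s by auto
  have "((\<lambda>t. f 0 t) has_vector_derivative 0) (at s within {0..})"
    by (rule has_vector_derivative_transform[where f = "\<lambda>_. 0"]) (use s f0 in auto)
  then have Q0: "Q s 0 = 0"
    unfolding Q(3) time_deriv_def
    by (rule vector_derivative_within[OF at_within_atLeast_neq_bot[OF s]])
  obtain k where k: "continuous_on (cball 0 1) k" "k holomorphic_on ball 0 1" "\<And>z. Q s z = z * k z"
    "k 0 = deriv (Q s) 0"
    using divide_zero_at_origin[OF cQ hQ Q0] by blast
  define g where "g = (\<lambda>z. space_deriv f z s)"
  have "g analytic_on cball 0 1"
    using analytic_deriv[OF an[OF s]] by (simp add: g_def space_deriv_def[abs_def])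
  then have hg: "g holomorphic_on cball 0 1" by (rule analytic_imp_holomorphic)
  have gnz: "g z \<noteq> 0" if "z \<in> cball 0 1" for z using nz[OF s that] by (simp add: g_def)
  show thesis
  proof
    let ?P = "\<lambda>z. k z / g z"
    let ?p = "Re (deriv (Q s) 0) / Re (g 0)"
    show "continuous_on (cball 0 1) ?P"
      using gnz by (intro continuous_intros k holomorphic_on_imp_continuous_on[OF hg]) auto
    show "?P holomorphic_on ball 0 1"
      using gnz by (intro holomorphic_intros k holomorphic_on_subset[OF hg]) auto
    show td: "time_deriv f z s = z * space_deriv f z s * ?P z" if "z \<in> cball 0 1" for z
      using gnz[OF that] k(3)[of z] Q(3)[of z] by (simp add: g_def)
    show "Re (?P z) > 0" if z: "cmod z = 1" for z
    proof -
      have zc: "z \<in> cball 0 1" using z by auto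
      have "q s = Re (z * g z * ?P z * cnj (z * g z))"
        using PG[OF z] td[OF zc] by (simp add: g_def)
      also have "z * g z * ?P z * cnj (z * g z) = of_real ((cmod (z * g z))\<^sup>2) * ?P z"
        unfolding complex_norm_square by (simp add: mult_ac)
      also have "Re \<dots> = (cmod (z * g z))\<^sup>2 * Re (?P z)" by (simp only: Re_complex_of_real scaleR_complex.simps(1) flip: scaleR_conv_of_real)
      finally have "0 < (cmod (z * g z))\<^sup>2 * Re (?P z)" using q by simp
      then show ?thesis by (simp add: zero_less_mult_iff)
    qed
    \<comment> \<open>\<open>f'(0,t)\<close> is real at every time, hence so is its time
      derivative.\<close>
    have im0: "Im (deriv (Q s) 0) = 0"
    proof -
      have "((\<lambda>t. Im (space_deriv f 0 t)) has_vector_derivative Im (deriv (Q s) 0)) (at s within {0..})"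
        using bounded_linear.has_vector_derivative[OF bounded_linear_Im dQ] by (simp add: space_deriv_def)
      moreover have "((\<lambda>t. Im (space_deriv f 0 t)) has_vector_derivative 0) (at s within {0..})"
        by (rule has_vector_derivative_transform[where f = "\<lambda>_. 0"]) (use s im in auto)
      ultimately show ?thesis
        using vector_derivative_unique_within[OF at_within_atLeast_neq_bot[OF s]] by blast
    qed
    show "?P 0 = complex_of_real ?p"
      using im[OF s] im0 by (simp add: k(4) g_def complex_eq_iff Re_divide Im_divide power2_eq_square)
    have "((\<lambda>t. Re (space_deriv f 0 t)) has_vector_derivative Re (deriv (Q s) 0)) (at s within {0..})"
      using bounded_linear.has_vector_derivative[OF bounded_linear_Re dQ] by (simp add: space_deriv_def)
    then show "((\<lambda>t. Re (space_deriv f 0 t)) has_real_derivative ?p * Re (space_deriv f 0 s)) (at s within {0..})"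
      using rp[OF s] by (simp add: has_real_derivative_iff_has_vector_derivative g_def)
  qed
qed

section \<open>Reflection of the rational form in the unit circle\<close>

lemma cnj_eq_inverse_on_circle: "cmod z = 1 \<Longrightarrow> cnj z = 1 / z"
  using complex_norm_square[of z] by (cases "z = 0") (auto simp: nonzero_eq_divide_eq mult.commute)

text \<open>On the circle \<open>cnj (z - v) = (1 - cnj v * z) / z\<close>, so the conjugate of
  \<open>g\<close> extends to a rational function with poles at the reflected points. The factor
  \<open>z ^ m\<close> clears the powers of \<open>z\<close> in the denominator, and
  \<open>N\<close> is nonzero at the reflected poles because zeros and poles of \<open>g\<close> are
  distinct.\<close>

lemma rational_form_reflected:
  assumes "rational_form g m n b \<omega> \<zeta>" "m \<ge> n" "t \<ge> 0"
  obtains N where "N holomorphic_on UNIV"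
    "\<And>z. cmod z = 1 \<Longrightarrow> cnj (g z t) * z ^ m = N z / (\<Prod>i\<in>{1..n}. 1 - cnj (\<zeta> i t) * z)"
    "\<And>j. j \<in> {1..n} \<Longrightarrow> N (1 / cnj (\<zeta> j t)) \<noteq> 0"
proof -
  obtain d :: nat where d: "d \<le> m" and b: "b t \<noteq> 0" and "\<forall>k\<in>{1..d}. cmod (\<omega> k t) > 1"
    and ze: "\<forall>j\<in>{1..n}. cmod (\<zeta> j t) > 1" and ne: "\<forall>k\<in>{1..d}. \<forall>j\<in>{1..n}. \<omega> k t \<noteq> \<zeta> j t"
    and g: "\<forall>z\<in>cball 0 1. g z t = b t * (\<Prod>k=1..d. z - \<omega> k t) / (\<Prod>j=1..n. z - \<zeta> j t)"
  proof -
    obtain d :: "real \<Rightarrow> nat" and t0 where D: "\<forall>t\<ge>0. d t = m \<or> (m = n \<and> t = t0 \<and> d t < n)"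
      "\<forall>t\<ge>0. b t \<noteq> 0 \<and> (\<forall>k\<in>{1..d t}. cmod (\<omega> k t) > 1) \<and> (\<forall>j\<in>{1..n}. cmod (\<zeta> j t) > 1) \<and>
         (\<forall>k\<in>{1..d t}. \<forall>j\<in>{1..n}. \<omega> k t \<noteq> \<zeta> j t) \<and>
         (\<forall>z\<in>cball 0 1. g z t = b t * (\<Prod>k=1..d t. z - \<omega> k t) / (\<Prod>j=1..n. z - \<zeta> j t))"
      using assms(1) unfolding rational_form_def by blast
    have "d t \<le> m" using D(1) assms by fastforce
    then show thesis using D(2)[rule_format, OF \<open>t \<ge> 0\<close>] by (intro that[of "d t"]) blast+
  qed
  have r: "cnj (\<Prod>k=1..e. z - v k) = (\<Prod>k=1..e. 1 - cnj (v k) * z) / z ^ e" if "cmod z = 1" for z v and e :: nat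
  proof -
    have z: "z \<noteq> 0" "cnj z = 1 / z"
      using that cnj_eq_inverse_on_circle[of z] by auto
    have "cnj (\<Prod>k=1..e. z - v k) = (\<Prod>k=1..e. (1 - cnj (v k) * z) / z)"
      by (simp add: z diff_divide_distrib)
    also have "\<dots> = (\<Prod>k=1..e. 1 - cnj (v k) * z) / z ^ e" by (simp add: prod_dividef)
    finally show ?thesis .
  qed
  show thesis
  proof
    \<comment> \<open>The \<open>n\<close> denominator factors contribute \<open>z ^ n\<close>, and
      \<open>z ^ m / z ^ d\<close> leaves \<open>m - d\<close>, which is positive when the numerator
      degree drops.\<close>
    let ?N = "\<lambda>z. cnj (b t) * z ^ (n + (m - d)) * (\<Prod>k=1..d. 1 - cnj (\<omega> k t) * z)"
    show "?N holomorphic_on UNIV" by (intro holomorphic_intros)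
    show "cnj (g z t) * z ^ m = ?N z / (\<Prod>i\<in>{1..n}. 1 - cnj (\<zeta> i t) * z)" if z: "cmod z = 1" for z
    proof -
      have "z \<noteq> 0" using z by auto
      have "cnj (g z t) = cnj (b t) * cnj (\<Prod>k=1..d. z - \<omega> k t) / cnj (\<Prod>j=1..n. z - \<zeta> j t)"
        using g z by simp
      then show ?thesis
        using d \<open>z \<noteq> 0\<close> unfolding r[OF z] by (simp add: power_add power_diff)
    qed
    show "?N (1 / cnj (\<zeta> j t)) \<noteq> 0" if "j \<in> {1..n}" for j
    proof -
      have "\<zeta> j t \<noteq> 0" using ze that by fastforce
      have "1 - cnj (\<omega> k t) * (1 / cnj (\<zeta> j t)) \<noteq> 0" if k: "k \<in> {1..d}" for k
      proof -
        have "\<omega> k t \<noteq> \<zeta> j t" using ne k \<open>j \<in> {1..n}\<close> by blast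
        then show ?thesis using \<open>\<zeta> j t \<noteq> 0\<close> by simp
      qed
      then show ?thesis using b \<open>\<zeta> j t \<noteq> 0\<close> by simp
    qed
  qed
qed

section \<open>Motion of the poles\<close>

lemma has_field_derivative_prod_one_minus:
  fixes a :: "'i \<Rightarrow> complex"
  assumes "finite A"
  shows "((\<lambda>z. \<Prod>i\<in>A. 1 - a i * z) has_field_derivative
          (\<Sum>i\<in>A. - a i * (\<Prod>k\<in>A - {i}. 1 - a k * z))) (at z)"
  by (rule has_field_derivative_prod[THEN DERIV_cong]) (auto intro!: derivative_eq_intros)

text \<open>The logarithmic derivative of the product, which exposes its simple poles.\<close>

lemma sum_prod_remove_eq:
  fixes a :: "'i \<Rightarrow> complex"
  assumes "finite A" "\<And>i. i \<in> A \<Longrightarrow> 1 - a i * z \<noteq> 0"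
  shows "(\<Sum>i\<in>A. - a i * (\<Prod>k\<in>A - {i}. 1 - a k * z)) =
         - (\<Prod>i\<in>A. 1 - a i * z) * (\<Sum>i\<in>A. a i / (1 - a i * z))"
proof -
  have "- a i * (\<Prod>k\<in>A - {i}. 1 - a k * z) = - (\<Prod>i\<in>A. 1 - a i * z) * (a i / (1 - a i * z))" if "i \<in> A" for i
    using assms(2)[OF that] by (simp add: prod.remove[OF assms(1) that])
  then show ?thesis by (simp add: sum_distrib_left)
qed

text \<open>The moments at times \<open>t\<close> and \<open>s\<close> against one test function
  \<open>H t\<close> yield \<open>(t - s) * B t = (x j t - y) * c t\<close> with \<open>B\<close>
  and \<open>c\<close> continuous and \<open>c s \<noteq> 0\<close>. Thus mere continuity of the
  poles already forces differentiability, with derivative \<open>B s / c s\<close>.\<close>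

lemma pole_velocity:
  assumes sol: "locally_univalent_PG_solution q f"
    and rat: "rational_form (space_deriv f) m n b \<omega> \<zeta>" and mn: "m \<ge> n"
    and s: "s \<ge> 0" and j: "j \<in> {1..n}"
    and cP: "continuous_on (cball 0 1) P" and hP: "P holomorphic_on ball 0 1"
    and LK: "\<And>z. z \<in> cball 0 1 \<Longrightarrow> time_deriv f z s = z * space_deriv f z s * P z"
  shows "((\<lambda>t. cnj (\<zeta> j t)) has_vector_derivative cnj (\<zeta> j s) * P (1 / cnj (\<zeta> j s))) (at s within {0..})"
proof -
  have an: "(\<lambda>z. f z t) analytic_on cball 0 1"
    and nz: "\<And>z. z \<in> cball 0 1 \<Longrightarrow> space_deriv f z t \<noteq> 0" if "t \<ge> 0" for t
    using sol that by (auto simp: locally_univalent_PG_solution_def)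
  have sm: "smooth_in_time f"
    and PG: "\<And>z. cmod z = 1 \<Longrightarrow> Re (time_deriv f z s * cnj (z * space_deriv f z s)) = q s"
    using sol s by (auto simp: locally_univalent_PG_solution_def)
  obtain Q where Q: "continuous_on ({0..} \<times> cball 0 1) (\<lambda>(t, z). Q t z)"
    "\<And>t z. t \<ge> 0 \<Longrightarrow> z \<in> cball 0 1 \<Longrightarrow> f z t - f z s = of_real (t - s) * Q t z"
    "\<And>z. Q s z = time_deriv f z s"
    using smooth_in_time_quotient[OF sm s] by blast
  define x where "x = (\<lambda>i t. cnj (\<zeta> i t))"
  define y where "y = x j s"
  have cx: "continuous_on {0..} (x i)" if "i \<in> {1..n}" for i
    using rat that unfolding rational_form_def x_def by (intro continuous_intros) auto
  have x1: "cmod (x i t) > 1" if "i \<in> {1..n}" "t \<ge> 0" for i t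
    using rat that unfolding rational_form_def x_def by auto
  \<comment> \<open>The coincidences at \<open>t\<close> and at \<open>s\<close> are both compared
    with those at time 0.\<close>
  have pat: "x i t = x j t \<longleftrightarrow> x i s = x j s" if "i \<in> {1..n}" "t \<ge> 0" for i t
  proof -
    have "\<forall>i\<in>{1..n}. \<forall>j\<in>{1..n}. \<forall>t\<ge>0. \<zeta> i t = \<zeta> j t \<longleftrightarrow> \<zeta> i 0 = \<zeta> j 0"
      by (rule conjunct2[OF conjunct2[OF rat[unfolded rational_form_def]]])
    from this[rule_format, OF that(1) j that(2)] this[rule_format, OF that(1) j s]
    show ?thesis by (simp add: x_def)
  qed
  have y1: "cmod y > 1" using x1[OF j s] by (simp add: y_def)
  then have y0: "y \<noteq> 0" by auto
  \<comment> \<open>\<open>I\<close> collects the labels of the poles that coincide with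
    \<open>\<zeta> j\<close>, at \<open>s\<close> and hence always; \<open>p\<close> is the
    multiplicity.\<close>
  define I where "I = {i \<in> {1..n}. x i s = y}"
  define K where "K = {1..n} - I"
  define p where "p = card I"
  have fin: "finite I" "finite K" by (auto simp: I_def K_def)
  have p0: "p > 0" using j fin unfolding p_def card_gt_0_iff by (auto simp: I_def y_def)
  have lnz: "1 - x i t * z \<noteq> 0" if "i \<in> {1..n}" "t \<ge> 0" "cmod z = 1" for i t z
  proof
    assume "1 - x i t * z = 0"
    then have "cmod (x i t * z) = 1" by simp
    then show False using x1[OF that(1,2)] that(3) by (simp add: norm_mult)
  qed
  have ynz: "1 - y * z \<noteq> 0" if "cmod z = 1" for z
    using lnz[OF j s that] by (simp add: y_def)
  have ynz1: "y * z \<noteq> 1" if "cmod z = 1" for z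
    using ynz[OF that] by simp
  define D where "D = (\<lambda>t z. \<Prod>i\<in>{1..n}. 1 - x i t * z)"
  define D' where "D' = (\<lambda>t z. \<Sum>i\<in>{1..n}. - x i t * (\<Prod>k\<in>{1..n} - {i}. 1 - x k t * z))"
  define R where "R = (\<lambda>t z. \<Prod>i\<in>K. 1 - x i t * z)"
  define dR where "dR = deriv (R s)"
  \<comment> \<open>\<open>H t\<close> cancels all reflected poles at time \<open>t\<close>, so its moment at time \<open>t\<close> is exactly 0; the
    factor \<open>R s\<close> removes from its moment at time \<open>s\<close> all poles but those that coincide with \<open>\<zeta> j\<close>.\<close>
  define E where "E = (\<lambda>z. z ^ (m + 2) * R s z)"
  define E' where "E' = (\<lambda>z. z ^ (m + 1) * (of_nat (m + 2) * R s z + z * dR z))"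
  define H where "H = (\<lambda>t z. E z * D t z)"
  define H' where "H' = (\<lambda>t z. E' z * D t z + E z * D' t z)"
  have Dnz: "D t z \<noteq> 0" if "t \<ge> 0" "cmod z = 1" for t z
    using lnz that by (simp add: D_def)
  have D_split: "D t z = R t z * (1 - x j t * z) ^ p" if t: "t \<ge> 0" for t z
  proof -
    have "D t z = R t z * (\<Prod>i\<in>I. 1 - x i t * z)"
      unfolding D_def R_def K_def by (rule prod.subset_diff) (auto simp: I_def)
    also have "(\<Prod>i\<in>I. 1 - x i t * z) = (\<Prod>i\<in>I. 1 - x j t * z)"
      using pat t by (intro prod.cong) (auto simp: I_def y_def)
    finally show ?thesis by (simp add: p_def)
  qed
  have hR: "R t holomorphic_on A" and hD: "D t holomorphic_on A" and hD': "D' t holomorphic_on A" for t A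
    unfolding R_def D_def D'_def by (intro holomorphic_intros)+
  have hdR: "dR holomorphic_on A" for A
    unfolding dR_def using holomorphic_deriv[OF hR[of s UNIV] open_UNIV] holomorphic_on_subset by blast
  have dD: "(D t has_field_derivative D' t z) (at z)" for t z
    unfolding D_def D'_def by (rule has_field_derivative_prod_one_minus) simp
  have dR: "(R s has_field_derivative dR z) (at z)" for z
    unfolding dR_def using holomorphic_derivI[OF hR open_UNIV] by blast
  have dE: "(E has_field_derivative E' z) (at z)" for z
    unfolding E_def E'_def
    by (rule derivative_eq_intros dR refl)+ (simp add: algebra_simps)
  have dH: "(H t has_field_derivative H' t z) (at z)" for t z
    unfolding H_def H'_def
    by (rule derivative_eq_intros dE dD refl)+ (simp add: algebra_simps)
  have hE: "E holomorphic_on A" "E' holomorphic_on A" for A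
    unfolding E_def E'_def by (intro holomorphic_intros hR hdR)+
  note cont = holomorphic_on_imp_continuous_on
  have cR: "continuous_on ({0..} \<times> sphere 0 1) (\<lambda>p. R (fst p) (snd p))"
    and cD: "continuous_on ({0..} \<times> sphere 0 1) (\<lambda>p. D (fst p) (snd p))"
    and cD': "continuous_on ({0..} \<times> sphere 0 1) (\<lambda>p. D' (fst p) (snd p))"
    unfolding R_def D_def D'_def K_def
    by (intro continuous_intros continuous_on_compose2[OF cx, of _ _ fst]; auto)+
  have cQ: "continuous_on ({0..} \<times> sphere 0 1) (\<lambda>p. Q (fst p) (snd p))"
    by (rule continuous_on_subset[OF Q(1)[unfolded case_prod_beta]]) auto
  have cH': "continuous_on ({0..} \<times> sphere 0 1) (\<lambda>p. H' (fst p) (snd p))"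
    unfolding H'_def
    by (intro continuous_intros cD cD' continuous_on_compose2[OF cont[OF hE(1)[of UNIV]], of _ snd]
         continuous_on_compose2[OF cont[OF hE(2)[of UNIV]], of _ snd]) auto
  have reflected: "\<exists>N. N holomorphic_on UNIV \<and> N (1 / x j t) \<noteq> 0 \<and>
      (\<forall>z. cmod z = 1 \<longrightarrow> cnj (space_deriv f z t) * z ^ m = N z / D t z)" if "t \<ge> 0" for t
  proof (rule rational_form_reflected[OF rat mn that])
    fix N assume "N holomorphic_on UNIV"
      "\<And>z. cmod z = 1 \<Longrightarrow> cnj (space_deriv f z t) * z ^ m = N z / (\<Prod>i\<in>{1..n}. 1 - cnj (\<zeta> i t) * z)"
      "\<And>j. j \<in> {1..n} \<Longrightarrow> N (1 / cnj (\<zeta> j t)) \<noteq> 0"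
    then show ?thesis using j by (intro exI[of _ N]) (simp add: x_def D_def)
  qed
  from reflected[OF s] obtain N where N: "N holomorphic_on UNIV"
    "\<And>z. cmod z = 1 \<Longrightarrow> cnj (space_deriv f z s) * z ^ m = N z / D s z" "N (1 / y) \<noteq> 0"
    unfolding y_def by blast
  have hN: "N holomorphic_on A" for A using N(1) holomorphic_on_subset by blast

  \<comment> \<open>The displacement identity\<close>
  define v where "v = (\<lambda>t z. (1 - x j t * z) / (1 - y * z))"
  \<comment> \<open>The geometric sum comes from factoring \<open>1 - v ^ p\<close>, where
    \<open>1 - v\<close> contains the displacement \<open>x j t - y\<close> linearly. So
    \<open>c\<close> is what remains of the moment after this displacement is taken out.\<close>
  define c where "c = (\<lambda>t. circ_int (\<lambda>z. N z * R t z * z * (\<Sum>k<p. v t z ^ k) / (1 - y * z)))"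
  define B where "B = (\<lambda>t. circ_int (\<lambda>z. cnj (Q t z) * H' t z))"
  have cv: "continuous_on ({0..} \<times> sphere 0 1) (\<lambda>p. v (fst p) (snd p))"
    unfolding v_def
    by (intro continuous_intros continuous_on_compose2[OF cx[OF j], of _ fst]) (auto simp: ynz1)
  have cc: "continuous_on {0..} c"
    unfolding c_def
    by (rule circ_int_continuous_param, unfold case_prod_beta,
       intro continuous_intros cR cv continuous_on_compose2[OF cont[OF N(1)], of _ snd]) (auto simp: ynz1)
  have cB: "continuous_on {0..} B"
    unfolding B_def
    by (rule circ_int_continuous_param, unfold case_prod_beta, intro continuous_intros cQ cH')

  have parts: "circ_int (\<lambda>z. cnj (f z \<tau>) * H' t z) = circ_int (\<lambda>z. cnj (space_deriv f z \<tau>) * H t z / z\<^sup>2)"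
    if "\<tau> \<ge> 0" "t \<ge> 0" for \<tau> t
    unfolding space_deriv_def
  proof (rule circ_int_by_parts[OF _ dH])
    show "(\<lambda>z. f z \<tau>) analytic_on sphere 0 1"
      using an[OF that(1)] by (rule analytic_on_subset) auto
    show "continuous_on (sphere 0 1) (H' t)"
      unfolding H'_def by (intro continuous_intros cont hE hD hD')
  qed
  have moment0: "circ_int (\<lambda>z. cnj (space_deriv f z t) * H t z / z\<^sup>2) = 0" if t: "t \<ge> 0" for t
  proof -
    from reflected[OF t] obtain M where M: "M holomorphic_on UNIV"
      "\<And>z. cmod z = 1 \<Longrightarrow> cnj (space_deriv f z t) * z ^ m = M z / D t z" by blast
    have hM: "M holomorphic_on A" for A using M(1) holomorphic_on_subset by blast
    have "circ_int (\<lambda>z. cnj (space_deriv f z t) * H t z / z\<^sup>2) = circ_int (\<lambda>z. M z * R s z)"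
    proof (rule circ_int_cong)
      fix z :: complex assume z: "cmod z = 1"
      then have "z \<noteq> 0" by auto
      \<comment> \<open>Of the power \<open>m + 2\<close> in \<open>E\<close>, two cancel the
        \<open>z\<^sup>2\<close> from integration by parts and \<open>m\<close> reflect
        \<open>f'\<close>.\<close>
      then have "cnj (space_deriv f z t) * H t z / z\<^sup>2 = (cnj (space_deriv f z t) * z ^ m) * R s z * D t z"
        by (simp add: H_def E_def power_add power2_eq_square)
      then show "cnj (space_deriv f z t) * H t z / z\<^sup>2 = M z * R s z"
        using M(2)[OF z] Dnz[OF t z] by simp
    qed
    also have "\<dots> = 0"
      by (intro Cauchy_circ_int continuous_intros holomorphic_intros cont hM hR)
    finally show ?thesis .
  qed
  \<comment> \<open>At time \<open>s\<close> the factor \<open>R s * D t / D s\<close> equals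
    \<open>R t * v t ^ p\<close>. Splitting off the entire function \<open>N * R t\<close>, whose
    integral is 0, brings out the displacement, also for a multiple pole.\<close>
  have moment: "circ_int (\<lambda>z. cnj (space_deriv f z s) * H t z / z\<^sup>2) = - ((x j t - y) * c t)" if t: "t \<ge> 0" for t
  proof -
    let ?F = "\<lambda>z. N z * R t z * z * (\<Sum>k<p. v t z ^ k) / (1 - y * z)"
    have "circ_int (\<lambda>z. cnj (space_deriv f z s) * H t z / z\<^sup>2) = circ_int (\<lambda>z. N z * R t z - (x j t - y) * ?F z)"
    proof (rule circ_int_cong)
      fix z :: complex assume z: "cmod z = 1"
      then have z0: "z \<noteq> 0" by auto
      have Rs: "R s z \<noteq> 0" using Dnz[OF s z] D_split[OF s] by auto
      have "cnj (space_deriv f z s) * H t z / z\<^sup>2 = (cnj (space_deriv f z s) * z ^ m) * R s z * D t z"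
        using z0 by (simp add: H_def E_def power_add power2_eq_square)
      also have "\<dots> = N z / D s z * R s z * D t z" using N(2)[OF z] by simp
      also have "\<dots> = N z * R t z * v t z ^ p"
        using Rs by (simp add: D_split[OF s] D_split[OF t] v_def power_divide y_def)
      also have "\<dots> = N z * R t z - N z * R t z * (1 - v t z ^ p)" by (simp add: algebra_simps)
      also have "1 - v t z ^ p = (1 - v t z) * (\<Sum>k<p. v t z ^ k)" by (rule one_diff_power_eq)
      also have "1 - v t z = (x j t - y) * z / (1 - y * z)"
        using ynz[OF z] by (simp add: v_def divide_simps) (simp add: algebra_simps)
      finally show "cnj (space_deriv f z s) * H t z / z\<^sup>2 = N z * R t z - (x j t - y) * ?F z"
        by (simp add: mult_ac)
    qed
    also have "\<dots> = circ_int (\<lambda>z. N z * R t z) - circ_int (\<lambda>z. (x j t - y) * ?F z)"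
    proof (intro contour_integral_diff circ_integrable)
      show "continuous_on (sphere 0 1) (\<lambda>z. N z * R t z)"
        by (intro continuous_intros cont hN hR)
      show "continuous_on (sphere 0 1) (\<lambda>z. (x j t - y) * ?F z)"
        unfolding v_def using ynz1 by (intro continuous_intros cont hN hR) auto
    qed
    also have "circ_int (\<lambda>z. (x j t - y) * ?F z) = (x j t - y) * c t"
      unfolding c_def
    proof (intro contour_integral_lmul circ_integrable)
      show "continuous_on (sphere 0 1) ?F"
        unfolding v_def using ynz1 by (intro continuous_intros cont hN hR) auto
    qed
    also have "circ_int (\<lambda>z. N z * R t z) = 0"
      by (intro Cauchy_circ_int continuous_intros holomorphic_intros cont hN hR)
    finally show ?thesis by simp
  qed
  \<comment> \<open>The difference of the moments of \<open>f\<close> at \<open>t\<close> and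
    \<open>s\<close>, computed once through \<open>Q\<close> and once through residues.\<close>
  have key: "of_real (t - s) * B t = (x j t - y) * c t" if t: "t \<ge> 0" for t
  proof -
    have ci: "(\<lambda>z. cnj (f z \<tau>) * H' t z) contour_integrable_on circlepath 0 1" if "\<tau> \<ge> 0" for \<tau>
    proof (intro circ_integrable continuous_intros)
      show "continuous_on (sphere 0 1) (\<lambda>z. f z \<tau>)"
        using an[OF that] by (metis analytic_imp_holomorphic analytic_on_subset cont sphere_cball)
      show "continuous_on (sphere 0 1) (H' t)"
        unfolding H'_def by (intro continuous_intros cont hE hD hD')
    qed
    have "of_real (t - s) * B t = circ_int (\<lambda>z. of_real (t - s) * (cnj (Q t z) * H' t z))"
      unfolding B_def
    proof (rule contour_integral_lmul[symmetric], intro circ_integrable continuous_intros)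
      show "continuous_on (sphere 0 1) (Q t)"
        using continuous_on_section[OF Q(1)] t continuous_on_subset by fastforce
      show "continuous_on (sphere 0 1) (H' t)"
        unfolding H'_def by (intro continuous_intros cont hE hD hD')
    qed
    also have "\<dots> = circ_int (\<lambda>z. cnj (f z t) * H' t z - cnj (f z s) * H' t z)"
    proof (rule circ_int_cong)
      fix z :: complex assume "cmod z = 1"
      then have "cmod z \<le> 1" by simp
      then have "cnj (f z t - f z s) = cnj (of_real (t - s) * Q t z)"
        using Q(2)[OF t, of z] by (simp only: mem_cball_0)
      then have "cnj (f z t) - cnj (f z s) = of_real (t - s) * cnj (Q t z)"
        by (simp only: complex_cnj_diff complex_cnj_mult complex_cnj_complex_of_real)
      then show "of_real (t - s) * (cnj (Q t z) * H' t z) = cnj (f z t) * H' t z - cnj (f z s) * H' t z"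
        by (metis left_diff_distrib mult.assoc)
    qed
    also have "\<dots> = circ_int (\<lambda>z. cnj (f z t) * H' t z) - circ_int (\<lambda>z. cnj (f z s) * H' t z)"
      by (rule contour_integral_diff[OF ci[OF t] ci[OF s]])
    finally show ?thesis
      using parts[OF t t] parts[OF s t] moment0[OF t] moment[OF t] by simp
  qed

  \<comment> \<open>Residues at time \<open>s\<close>\<close>
  define \<Psi> where "\<Psi> = (\<lambda>z. N z * z * R s z)"
  have h\<Psi>: "\<Psi> holomorphic_on A" for A unfolding \<Psi>_def by (intro holomorphic_intros hN hR)
  \<comment> \<open>The factors of \<open>R s\<close> belong to poles different from
    \<open>\<zeta> j\<close>.\<close>
  have "R s (1 / y) \<noteq> 0"
    using fin y0 by (auto simp: R_def K_def I_def)
  then have \<Psi>0: "\<Psi> (1 / y) \<noteq> 0" using N(3) y0 by (auto simp: \<Psi>_def)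
  \<comment> \<open>At \<open>t = s\<close> the function \<open>v\<close> is 1 on the circle, so the
    geometric sum becomes \<open>p\<close>.\<close>
  have c_s: "c s = - (2 * pi * \<i> / y * (of_nat p * \<Psi> (1 / y)))"
  proof -
    have "c s = circ_int (\<lambda>z. (of_nat p * \<Psi> z) / (1 - y * z))"
      unfolding c_def
    proof (rule circ_int_cong)
      fix z :: complex assume z: "cmod z = 1"
      have "v s z = 1" using ynz[OF z] by (simp add: v_def y_def)
      then show "N z * R s z * z * (\<Sum>k<p. v s z ^ k) / (1 - y * z) = of_nat p * \<Psi> z / (1 - y * z)"
        by (simp add: \<Psi>_def)
    qed
    also have "\<dots> = - (2 * pi * \<i> / y * (of_nat p * \<Psi> (1 / y)))"
      by (intro Cauchy_circ_int_reflected_pole y1 continuous_intros holomorphic_intros cont h\<Psi>)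
    finally show ?thesis .
  qed
  have B_s: "B s = - (2 * pi * \<i> * (of_nat p * (P (1 / y) * \<Psi> (1 / y))))"
  proof -
    define g where "g = (\<lambda>z. space_deriv f z s)"
    have hg: "g holomorphic_on cball 0 1"
      using analytic_imp_holomorphic[OF analytic_deriv[OF an[OF s]]] by (simp add: g_def space_deriv_def[abs_def])
    have gnz: "g z \<noteq> 0" if "z \<in> cball 0 1" for z using nz[OF s that] by (simp add: g_def)
    define e where "e = (\<lambda>z. of_nat (m + 2) * R s z + z * dR z)"
    define L where "L = (\<lambda>z. e z * D s z + z * R s z * D' s z)"
    have he: "e holomorphic_on A" "L holomorphic_on A" for A
      unfolding L_def e_def by (intro holomorphic_intros hR hdR hD hD')+
    \<comment> \<open>\<open>?A\<close> is the part of the integrand without poles in the disk;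
      \<open>?T i\<close> carries the pole at \<open>1 / x i s\<close>.\<close>
    let ?A = "\<lambda>z. 2 * of_real (q s) * z ^ m * L z / g z - P z * N z * e z"
    let ?T = "\<lambda>i z. x i s * (P z * \<Psi> z / (1 - x i s * z))"
    have cT: "continuous_on (sphere 0 1) (\<lambda>z. P z * \<Psi> z / (1 - x i s * z))" if "i \<in> {1..n}" for i
      using lnz[OF that s, simplified] by (intro continuous_intros cont h\<Psi> continuous_on_subset[OF cP]) auto
    have cA: "continuous_on (cball 0 1) ?A"
      using gnz by (intro continuous_intros cont he hN hg cP) auto
    have hA: "?A holomorphic_on ball 0 1"
      using gnz by (intro holomorphic_intros he hN holomorphic_on_subset[OF hg] hP) auto
    have "B s = circ_int (\<lambda>z. ?A z + (\<Sum>i\<in>{1..n}. ?T i z))"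
      unfolding B_def
    proof (rule circ_int_cong)
      fix z :: complex assume z: "cmod z = 1"
      then have zc: "z \<in> cball 0 1" and z0: "z \<noteq> 0" by auto
      note cz = cnj_eq_inverse_on_circle[OF z]
      \<comment> \<open>Doubling the real part makes the equation linear in
        \<open>cnj (Q s z)\<close>, which can then be expressed through \<open>P\<close>,
        \<open>g\<close> and \<open>cnj (g z)\<close>.\<close>
      have "Q s z * cnj (z * g z) + cnj (Q s z * cnj (z * g z)) = 2 * of_real (q s)"
        using PG[OF z] by (simp only: complex_add_cnj Q(3) g_def) simp
      then have "z * g z * P z * cnj (z * g z) + cnj (Q s z) * (z * g z) = 2 * of_real (q s)"
        using LK[OF zc] by (simp add: Q(3) g_def)
      then have e: "z * g z * cnj (Q s z) + P z * g z * cnj (g z) = 2 * of_real (q s)"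
        using z0 by (simp add: cz mult_ac add.commute)
      have cQ: "cnj (Q s z) = 2 * of_real (q s) / (z * g z) - P z * cnj (g z) / z"
        unfolding e[symmetric] using z0 gnz[OF zc] by (simp add: add_divide_distrib)
      have gN: "cnj (g z) = N z / (D s z * z ^ m)"
        using N(2)[OF z] z0 by (simp add: g_def nonzero_eq_divide_eq flip: divide_divide_eq_left)
      \<comment> \<open>The factor \<open>z ^ (m + 1)\<close> cancels the powers of \<open>z\<close>
        in the denominators of \<open>cQ\<close> and \<open>gN\<close>, so no pole at 0 is
        left.\<close>
      have HL: "H' s z = z * z ^ m * L z"
        by (simp add: H'_def E'_def E_def L_def e_def algebra_simps)
      have D'D: "D' s z = - D s z * (\<Sum>i\<in>{1..n}. x i s / (1 - x i s * z))"
        unfolding D'_def D_def using lnz[OF _ s z] by (intro sum_prod_remove_eq) auto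
      then have LD: "L z = D s z * (e z - z * R s z * (\<Sum>i\<in>{1..n}. x i s / (1 - x i s * z)))"
        by (simp add: L_def algebra_simps)
      have "cnj (Q s z) * H' s z = 2 * of_real (q s) * z ^ m * L z / g z - P z * N z / D s z * L z"
        unfolding cQ HL gN using z0 gnz[OF zc] Dnz[OF s z]
        by (simp add: divide_simps) (simp add: algebra_simps)
      also have "P z * N z / D s z * L z = P z * N z * (e z - z * R s z * (\<Sum>i\<in>{1..n}. x i s / (1 - x i s * z)))"
        using Dnz[OF s z] unfolding LD by simp
      also have "\<dots> = P z * N z * e z - P z * \<Psi> z * (\<Sum>i\<in>{1..n}. x i s / (1 - x i s * z))"
        by (simp add: \<Psi>_def algebra_simps)
      also have "P z * \<Psi> z * (\<Sum>i\<in>{1..n}. x i s / (1 - x i s * z)) = (\<Sum>i\<in>{1..n}. ?T i z)"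
        by (simp add: sum_distrib_left mult_ac)
      finally show "cnj (Q s z) * H' s z = ?A z + (\<Sum>i\<in>{1..n}. ?T i z)" by simp
    qed
    also have "\<dots> = circ_int ?A + circ_int (\<lambda>z. \<Sum>i\<in>{1..n}. ?T i z)"
    proof (intro contour_integral_add circ_integrable)
      show "continuous_on (sphere 0 1) ?A" by (rule continuous_on_subset[OF cA]) auto
      show "continuous_on (sphere 0 1) (\<lambda>z. \<Sum>i\<in>{1..n}. ?T i z)"
        by (intro continuous_on_sum continuous_on_mult_left cT)
    qed
    also have "circ_int ?A = 0"
      by (rule Cauchy_circ_int[OF cA hA])
    also have "circ_int (\<lambda>z. \<Sum>i\<in>{1..n}. ?T i z) = (\<Sum>i\<in>{1..n}. circ_int (?T i))"
      by (intro contour_integral_sum circ_integrable continuous_on_mult_left cT) auto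
    also have "\<dots> = (\<Sum>i\<in>{1..n}. if i \<in> I then - (2 * pi * \<i> * (P (1 / y) * \<Psi> (1 / y))) else 0)"
    proof (rule sum.cong[OF refl])
      fix i assume i: "i \<in> {1..n}"
      have xi: "x i s \<noteq> 0" using x1[OF i s] by auto
      have "circ_int (?T i) = x i s * circ_int (\<lambda>z. P z * \<Psi> z / (1 - x i s * z))"
        by (intro contour_integral_lmul circ_integrable cT i)
      also have "circ_int (\<lambda>z. P z * \<Psi> z / (1 - x i s * z)) =
          - (2 * pi * \<i> / x i s * (P (1 / x i s) * \<Psi> (1 / x i s)))"
        by (intro Cauchy_circ_int_reflected_pole continuous_intros holomorphic_intros cP hP cont h\<Psi> x1 i s)
      finally have 1: "circ_int (?T i) = - (2 * pi * \<i> * (P (1 / x i s) * \<Psi> (1 / x i s)))"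
        using xi by simp
      show "circ_int (?T i) = (if i \<in> I then - (2 * pi * \<i> * (P (1 / y) * \<Psi> (1 / y))) else 0)"
      proof (cases "i \<in> I")
        case True
        then show ?thesis using 1 by (simp add: I_def)
      next
        case False
        then have "i \<in> K" using i by (simp add: K_def)
        \<comment> \<open>One of the factors of \<open>R s\<close> is \<open>1 - x i s * z\<close>,
          so \<open>\<Psi>\<close> kills the residue at every pole other than
          \<open>\<zeta> j\<close>.\<close>
        then have "R s (1 / x i s) = 0" using xi fin by (auto simp: R_def)
        then show ?thesis using 1 False by (simp add: \<Psi>_def)
      qed
    qed
    also have "\<dots> = - (2 * pi * \<i> * (of_nat p * (P (1 / y) * \<Psi> (1 / y))))"
    proof -
      have "{1..n} \<inter> I = I" by (auto simp: I_def)
      then show ?thesis by (simp add: sum.If_cases p_def)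
    qed
    finally show ?thesis by simp
  qed
  have cs0: "c s \<noteq> 0" using c_s \<Psi>0 y0 p0 by simp
  \<comment> \<open>The multiplicity and \<open>\<Psi> (1 / y)\<close> cancel, leaving the
    Loewner-Kufarev velocity.\<close>
  have ratio: "B s / c s = y * P (1 / y)"
    unfolding B_s c_s using \<Psi>0 y0 p0 by (simp add: field_simps)
  have "(x j has_vector_derivative B s / c s) (at s within {0..})"
  proof (rule has_vector_derivative_of_factor)
    show "continuous (at s within {0..}) (\<lambda>t. B t / c t)"
      using cB cc cs0 s by (intro continuous_intros) (auto simp: continuous_on_eq_continuous_within)
    have "(c \<longlongrightarrow> c s) (at s within {0..})"
      using cc s by (auto simp: continuous_on_def)
    then have "\<forall>\<^sub>F t in at s within {0..}. c t \<noteq> 0"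
      using cs0 by (rule tendsto_imp_eventually_ne)
    moreover have "\<forall>\<^sub>F t in at s within {0..}. t \<in> {0..}"
      unfolding eventually_at_filter by (intro always_eventually) auto
    ultimately show "\<forall>\<^sub>F t in at s within {0..}. x j t - x j s = of_real (t - s) * (B t / c t)"
    proof eventually_elim
      case (elim t)
      then show ?case using key[of t] by (simp add: y_def nonzero_eq_divide_eq)
    qed
  qed
  then show ?thesis unfolding ratio by (simp add: x_def y_def)
qed

section \<open>Comparison\<close>

text \<open>Only the radial component of the velocity changes the modulus, and for velocity
  \<open>x * w\<close> it is \<open>|x| * Re w\<close>.\<close>

lemma has_real_derivative_cmod:
  fixes x :: "real \<Rightarrow> complex"
  assumes x: "(x has_vector_derivative x s * w) (at s within S)" and nz: "x s \<noteq> 0"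
  shows "((\<lambda>t. cmod (x t)) has_real_derivative cmod (x s) * Re w) (at s within S)"
proof -
  have "((\<lambda>t. norm (x t)) has_derivative (\<lambda>h. sgn (x s) \<bullet> (h *\<^sub>R (x s * w)))) (at s within S)"
    using has_derivative_compose[OF x[unfolded has_vector_derivative_def] has_derivative_norm[OF nz]]
    by (simp add: inner_commute)
  moreover have "sgn (x s) \<bullet> (x s * w) = cmod (x s) * Re w"
  proof -
    have "x s \<bullet> (x s * w) = (cmod (x s))\<^sup>2 * Re w"
      by (simp add: inner_complex_def cmod_power2) (simp add: algebra_simps power2_eq_square)
    then show ?thesis using nz by (simp add: sgn_div_norm power2_eq_square)
  qed
  ultimately show ?thesis
    by (simp add: has_field_derivative_def mult_commute_abs)
qed

text \<open>For positive times the one-sided domain is a neighbourhood; at time 0 continuity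
  suffices.\<close>

lemma nondecreasing_from_zero:
  fixes F :: "real \<Rightarrow> real"
  assumes F: "\<And>s. s \<ge> 0 \<Longrightarrow> (F has_real_derivative F' s) (at s within {0..})"
    and "\<And>s. s \<ge> 0 \<Longrightarrow> F' s \<ge> 0" "t \<ge> 0"
  shows "F 0 \<le> F t"
proof (rule DERIV_nonneg_imp_increasing_open[OF \<open>t \<ge> 0\<close>])
  show "\<exists>y. (F has_real_derivative y) (at s) \<and> y \<ge> 0" if "0 < s" for s
  proof -
    have "(F has_real_derivative F' s) (at s within {0<..})"
      using F[of s] that by (auto intro: has_field_derivative_subset)
    then have "(F has_real_derivative F' s) (at s)"
      using at_within_open[of s "{0<..}"] that by simp
    then show ?thesis using assms(2)[of s] that by auto
  qed
  have "continuous_on {0..} F"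
    by (rule DERIV_continuous_on[of _ _ F']) (use F in auto)
  then show "continuous_on {0..t} F" by (rule continuous_on_subset) auto
qed

text \<open>\<open>\<rho> + 1 / \<rho> \<plusminus> 2 = (\<rho> \<plusminus> 1)\<^sup>2 / \<rho>\<close> is proportional to \<open>a\<close> in the extremal cases
  \<open>\<rho>' / \<rho> = p (\<rho> \<plusminus> 1) / (\<rho> \<minusplus> 1)\<close>, \<open>a' / a = p\<close>.\<close>

lemma extremal_comparison:
  fixes \<rho> a p r :: "real \<Rightarrow> real"
  assumes \<rho>: "\<And>s. s \<ge> 0 \<Longrightarrow> (\<rho> has_real_derivative \<rho> s * r s) (at s within {0..})"
    and a: "\<And>s. s \<ge> 0 \<Longrightarrow> (a has_real_derivative p s * a s) (at s within {0..})"
    and a0: "\<And>s. s \<ge> 0 \<Longrightarrow> a s > 0" and \<rho>1: "\<And>s. s \<ge> 0 \<Longrightarrow> \<rho> s > 1"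
    and lo: "\<And>s. s \<ge> 0 \<Longrightarrow> (\<rho> s - 1) / (\<rho> s + 1) * p s \<le> r s"
    and up: "\<And>s. s \<ge> 0 \<Longrightarrow> r s \<le> (\<rho> s + 1) / (\<rho> s - 1) * p s"
    and t: "t \<ge> 0"
  shows "(\<rho> 0 + 1 / \<rho> 0 - 2) / a 0 \<le> (\<rho> t + 1 / \<rho> t - 2) / a t"
    and "(\<rho> t + 1 / \<rho> t + 2) / a t \<le> (\<rho> 0 + 1 / \<rho> 0 + 2) / a 0"
proof -
  \<comment> \<open>Both monotone quantities are treated at once, with \<open>c = -2\<close> and
    \<open>c = 2\<close>.\<close>
  have der: "((\<lambda>t. (\<rho> t + 1 / \<rho> t + c) / a t) has_real_derivative
      ((\<rho> s - 1 / \<rho> s) * r s - (\<rho> s + 1 / \<rho> s + c) * p s) / a s) (at s within {0..})" if s: "s \<ge> 0" for s c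
  proof -
    have nz: "\<rho> s \<noteq> 0" "a s \<noteq> 0" using a0[OF s] \<rho>1[OF s] by auto
    show ?thesis
      by (rule derivative_eq_intros \<rho>[OF s] a[OF s] nz refl)+
         (use nz in \<open>simp add: field_simps power2_eq_square\<close>)
  qed
  have mono: "0 \<le> \<rho> s - 1 / \<rho> s" if s: "s \<ge> 0" for s
  proof -
    have "1 / \<rho> s < 1" using \<rho>1[OF s] by (simp add: divide_less_eq)
    then show ?thesis using \<rho>1[OF s] by linarith
  qed
  \<comment> \<open>With \<open>\<rho> - 1 / \<rho> = (\<rho> - 1) * (\<rho> + 1) / \<rho>\<close>,
    the Harnack factor replaces \<open>\<rho> + 1\<close> by \<open>\<rho> - 1\<close>, so the lower
    bound gives the sign of the derivative for \<open>c = -2\<close>. The upper bound acts in the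
    same way for \<open>c = 2\<close>.\<close>
  have lo': "(\<rho> s + 1 / \<rho> s - 2) * p s \<le> (\<rho> s - 1 / \<rho> s) * r s" if s: "s \<ge> 0" for s
  proof -
    have "(\<rho> s + 1 / \<rho> s - 2) * p s = (\<rho> s - 1 / \<rho> s) * ((\<rho> s - 1) / (\<rho> s + 1) * p s)"
      using \<rho>1[OF s] by (simp add: divide_simps) (simp add: algebra_simps)
    also have "\<dots> \<le> (\<rho> s - 1 / \<rho> s) * r s"
      by (intro mult_left_mono mono lo s)
    finally show ?thesis .
  qed
  have up': "(\<rho> s - 1 / \<rho> s) * r s \<le> (\<rho> s + 1 / \<rho> s + 2) * p s" if s: "s \<ge> 0" for s
  proof -
    have "(\<rho> s - 1 / \<rho> s) * r s \<le> (\<rho> s - 1 / \<rho> s) * ((\<rho> s + 1) / (\<rho> s - 1) * p s)"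
      by (intro mult_left_mono mono up s)
    also have "\<dots> = (\<rho> s + 1 / \<rho> s + 2) * p s"
      using \<rho>1[OF s] by (simp add: divide_simps) (simp add: algebra_simps)
    finally show ?thesis .
  qed
  show "(\<rho> 0 + 1 / \<rho> 0 - 2) / a 0 \<le> (\<rho> t + 1 / \<rho> t - 2) / a t"
    using nondecreasing_from_zero[OF der[of _ "-2"] _ t] lo' a0
    by (simp add: less_imp_le)
  show "(\<rho> t + 1 / \<rho> t + 2) / a t \<le> (\<rho> 0 + 1 / \<rho> 0 + 2) / a 0"
    using nondecreasing_from_zero[OF DERIV_minus[OF der[of _ 2]] _ t] up' a0
    by (simp add: less_imp_le divide_le_0_iff)
qed

theorem theorem6p1:
  fixes f :: "complex \<Rightarrow> real \<Rightarrow> complex"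
    and q :: "real \<Rightarrow> real"
    and m n :: nat
    and b :: "real \<Rightarrow> complex"
    and \<omega> \<zeta> :: "nat \<Rightarrow> real \<Rightarrow> complex"
    and a1 :: "real \<Rightarrow> real"
  defines "a1 \<equiv> (\<lambda>t. Re (space_deriv f 0 t))"
  assumes "continuous_on {0..} q"
    and "\<And>t. t \<ge> 0 \<Longrightarrow> q t > 0"
    and "filterlim (\<lambda>t. integral {0..t} q) at_top at_top"
    and "locally_univalent_PG_solution q f"
    and "m \<ge> n"
    and "rational_form (space_deriv f) m n b \<omega> \<zeta>"
  shows "\<forall>j\<in>{1..n}.
           comparable (\<lambda>t. cmod (\<zeta> j t)) a1 \<and>
           (\<forall>t\<ge>0.
              1 / a1 0 * (cmod (\<zeta> j 0) + 1 / cmod (\<zeta> j 0) - 2) \<le> cmod (\<zeta> j t) / a1 t \<and>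
              cmod (\<zeta> j t) / a1 t \<le> 1 / a1 0 * (cmod (\<zeta> j 0) + 1 / cmod (\<zeta> j 0) + 2))"
proof
  fix j assume j: "j \<in> {1..n}"
  define \<rho> where "\<rho> = (\<lambda>t. cmod (\<zeta> j t))"
  have \<rho>1: "\<rho> s > 1" if "s \<ge> 0" for s
    using assms(7) j that unfolding rational_form_def \<rho>_def by auto
  have a0: "a1 s > 0" if "s \<ge> 0" for s
    using assms(5) that by (auto simp: locally_univalent_PG_solution_def a1_def)
  have "\<exists>p r. (\<rho> has_real_derivative \<rho> s * r) (at s within {0..}) \<and>
      (a1 has_real_derivative p * a1 s) (at s within {0..}) \<and>
      (\<rho> s - 1) / (\<rho> s + 1) * p \<le> r \<and> r \<le> (\<rho> s + 1) / (\<rho> s - 1) * p" if s: "s \<ge> 0" for s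
  proof -
    obtain P p where P: "continuous_on (cball 0 1) P" "P holomorphic_on ball 0 1"
      "\<And>z. z \<in> cball 0 1 \<Longrightarrow> time_deriv f z s = z * space_deriv f z s * P z"
      "\<And>z. cmod z = 1 \<Longrightarrow> Re (P z) > 0" "P 0 = complex_of_real p"
      "((\<lambda>t. Re (space_deriv f 0 t)) has_real_derivative p * Re (space_deriv f 0 s)) (at s within {0..})"
      using PG_Loewner_Kufarev[OF assms(5) assms(3)[OF s] s] by metis
    \<comment> \<open>The reflected pole lies in the disk at distance \<open>1 / \<rho> s\<close>
      from 0, which turns Harnack's factors into those of
      \<open>extremal_comparison\<close>.\<close>
    define \<eta> where "\<eta> = 1 / cnj (\<zeta> j s)"
    have \<eta>: "cmod \<eta> = 1 / \<rho> s" "cmod \<eta> < 1"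
      using \<rho>1[OF s] by (auto simp: \<eta>_def \<rho>_def norm_divide divide_less_eq)
    have "((\<lambda>t. cnj (\<zeta> j t)) has_vector_derivative cnj (\<zeta> j s) * P \<eta>) (at s within {0..})"
      unfolding \<eta>_def by (rule pole_velocity[OF assms(5,7,6) s j P(1-3)])
    then have "(\<rho> has_real_derivative \<rho> s * Re (P \<eta>)) (at s within {0..})"
      using has_real_derivative_cmod[of "\<lambda>t. cnj (\<zeta> j t)"] \<rho>1[OF s] by (fastforce simp: \<rho>_def)
    moreover have "(1 - cmod \<eta>) / (1 + cmod \<eta>) = (\<rho> s - 1) / (\<rho> s + 1)"
      "(1 + cmod \<eta>) / (1 - cmod \<eta>) = (\<rho> s + 1) / (\<rho> s - 1)"
    proof -
      have "1 - cmod \<eta> = (\<rho> s - 1) / \<rho> s" "1 + cmod \<eta> = (\<rho> s + 1) / \<rho> s"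
        using \<rho>1[OF s] by (simp_all add: \<eta>(1) field_simps)
      then show "(1 - cmod \<eta>) / (1 + cmod \<eta>) = (\<rho> s - 1) / (\<rho> s + 1)"
        "(1 + cmod \<eta>) / (1 - cmod \<eta>) = (\<rho> s + 1) / (\<rho> s - 1)"
        using \<rho>1[OF s] by simp_all
    qed
    ultimately show ?thesis
      using Harnack_disk(1,2)[OF P(1,2,4) \<eta>(2) P(5)] P(6) unfolding a1_def by auto
  qed
  then obtain p r where pr: "\<And>s. s \<ge> 0 \<Longrightarrow> (\<rho> has_real_derivative \<rho> s * r s) (at s within {0..})"
    "\<And>s. s \<ge> 0 \<Longrightarrow> (a1 has_real_derivative p s * a1 s) (at s within {0..})"
    "\<And>s. s \<ge> 0 \<Longrightarrow> (\<rho> s - 1) / (\<rho> s + 1) * p s \<le> r s"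
    "\<And>s. s \<ge> 0 \<Longrightarrow> r s \<le> (\<rho> s + 1) / (\<rho> s - 1) * p s"
    by metis
  have bounds: "1 / a1 0 * (\<rho> 0 + 1 / \<rho> 0 - 2) \<le> \<rho> t / a1 t"
    "\<rho> t / a1 t \<le> 1 / a1 0 * (\<rho> 0 + 1 / \<rho> 0 + 2)" if t: "t \<ge> 0" for t
  proof -
    have "1 / \<rho> t \<le> 1" "1 / \<rho> t \<ge> 0" using \<rho>1[OF t] by auto
    then have "(\<rho> t + 1 / \<rho> t - 2) / a1 t \<le> \<rho> t / a1 t" "\<rho> t / a1 t \<le> (\<rho> t + 1 / \<rho> t + 2) / a1 t"
      using a0[OF t] by (auto intro!: divide_right_mono)
    then show "1 / a1 0 * (\<rho> 0 + 1 / \<rho> 0 - 2) \<le> \<rho> t / a1 t"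
      "\<rho> t / a1 t \<le> 1 / a1 0 * (\<rho> 0 + 1 / \<rho> 0 + 2)"
      using extremal_comparison[OF pr(1,2) a0 \<rho>1 pr(3,4) t] by simp_all
  qed
  \<comment> \<open>A positive square over \<open>\<rho> 0\<close>, since the pole starts strictly
    outside the closed disk; this makes the lower constant positive.\<close>
  have "\<rho> 0 + 1 / \<rho> 0 - 2 = (\<rho> 0 - 1)\<^sup>2 / \<rho> 0"
    using \<rho>1[of 0] by (simp add: field_simps power2_eq_square)
  then have "0 < 1 / a1 0 * (\<rho> 0 + 1 / \<rho> 0 - 2)"
    using \<rho>1[of 0] a0[of 0] by simp
  moreover have "1 / a1 0 * (\<rho> 0 + 1 / \<rho> 0 - 2) < 1 / a1 0 * (\<rho> 0 + 1 / \<rho> 0 + 2)"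
    using a0[of 0] by (intro mult_strict_left_mono) auto
  ultimately have "comparable \<rho> a1"
    unfolding comparable_def using bounds by blast
  then show "comparable (\<lambda>t. cmod (\<zeta> j t)) a1 \<and>
           (\<forall>t\<ge>0.
              1 / a1 0 * (cmod (\<zeta> j 0) + 1 / cmod (\<zeta> j 0) - 2) \<le> cmod (\<zeta> j t) / a1 t \<and>
              cmod (\<zeta> j t) / a1 t \<le> 1 / a1 0 * (cmod (\<zeta> j 0) + 1 / cmod (\<zeta> j 0) + 2))"
    using bounds unfolding \<rho>_def by blast
qed

end
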